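(* Let $n\ge 2$ and $m\ge 1$ be integers, let $u_0<u_1<\cdots<u_m<u_{m+1}=+\infty$ with $u_0,\dots,u_m$ real, let $a_i>0$, $k_i>0$ for $i=0,\dots,m$, $d_i\ge 0$ for $i=1,\dots,m$, and $A>0$. Then there exists a self-similar radial solution (in the sense defined in the context) of the $n$-dimensional multi-phase Stefan problem with constant initial data $u(0,x)\equiv u_0$ and growth condition $u(t,x)\sim A\,\mathcal{E}_n(|x|/(a_m\sqrt t))$ as $x\to0$; that is, there exist real numbers $+\infty=\xi_0>\xi_1>\cdots>\xi_m>0$ such that the function $u(t,x)=v(|x|/\sqrt t)$, with $v$ given by $$v(\xi)=u_m+A\bigl(G(\xi/a_m)-G(\xi_m/a_m)\bigr),\quad 0<\xi<\xi_m,$$ $$v(\xi)=u_i+\frac{(u_{i+1}-u_i)\bigl(G(\xi/a_i)-G(\xi_i/a_i)\bigr)}{G(\xi_{i+1}/a_i)-G(\xi_i/a_i)},\quad \xi_{i+1}<\xi<\xi_i,\ i=0,\ldots,m-1,$$ solves this problem.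
   Context: $G(y)=\int_y^{+\infty}s^{1-n}e^{-s^2/4}\,ds$ for $y>0$, with $G(+\infty)=0$. For $y>0$, $\mathcal{E}_n(y)=\frac{1}{(n-2)y^{n-2}}$ if $n\ge3$ and $\mathcal{E}_2(y)=-\ln y$. The Stefan problem is posed in the half-space $\{(t,x): t>0,\ x\in\mathbb{R}^n\}$ (for $x\neq 0$): (i) $u_t=a_i^2\Delta u$ in the regions where $u_i<u<u_{i+1}$, $i=0,\ldots,m$; (ii) on the (unknown) phase transition hypersurface where $u=u_i$, $i=1,\dots,m$, the Stefan condition $-d_i\nu_t+(k_i\nabla_xu_+-k_{i-1}\nabla_xu_-)\cdot\nu_x=0$ holds, where $\nu=(\nu_t,\nu_x)\in\mathbb{R}\times\mathbb{R}^n$, $\nu\ne0$, is a normal vector to the hypersurface directed from the $(i-1)$-th phase ($u_{i-1}<u<u_i$) to the $i$-th phase ($u_i<u<u_{i+1}$), and $\nabla_xu_-$, $\nabla_xu_+$ are the one-sided limits of $\nabla_xu$ from the colder and the warmer side respectively; (iii) $u(0,x)=u_0$ (as limit when $t\to0+$, $x\ne0$); (iv) $u(t,x)\sim A\,\mathcal{E}_n(|x|/(a_m\sqrt t))$ as $x\to0$. A self-similar radial solution here is a function $u(t,x)=v(|x|/\sqrt t)$ of the form displayed in the claim (extended continuously by $v(\xi_i)=u_i$), whose phase transition surfaces are $|x|=\xi_i\sqrt t$, $i=1,\dots,m$, satisfying (i)–(iv). For a function of this form, (i), (iii), (iv) hold automatically, and (ii) is equivalent to $$\frac{d_i\xi_i}{2}+k_iv'(\xi_i-0)-k_{i-1}v'(\xi_i+0)=0,\quad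 i=1,\ldots,m.$$ *)

theory Defs
  imports "HOL-Analysis.Analysis" "HOL-Library.Landau_Symbols"
begin

(* The argument is extended real so that G can be evaluated at xi_0 / a = \<infinity>,
   where the integral over the empty interval gives G(\<infinity>) = 0. *)
definition stefan_G :: "nat \<Rightarrow> ereal \<Rightarrow> real" where
  "stefan_G n y = (LBINT s=y..\<infinity>. s powi (1 - int n) * exp (- (s ^ 2) / 4))"

(* Only used for n \<ge> 2 and y > 0. *)
definition stefan_E :: "nat \<Rightarrow> real \<Rightarrow> real" where
  "stefan_E n y = (if n = 2 then - ln y else 1 / ((real n - 2) * y ^ (n - 2)))"

definition grad_x :: "(real \<Rightarrow> real^'n \<Rightarrow> real) \<Rightarrow> real \<times> (real^'n) \<Rightarrow> real^'n" where
  "grad_x u q = (THE D. GDERIV (u (fst q)) (snd q) :> D)"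

definition stefan_domain :: "(real \<times> (real^'n)) set" where
  "stefan_domain = {(t, x). 0 < t \<and> x \<noteq> 0}"

(* Phase i is U i < u < U (i + 1); for i = m there is no upper bound, which encodes the
   convention that the last phase transition temperature U (m + 1) is \<infinity>. *)
definition phase_region ::
    "nat \<Rightarrow> (nat \<Rightarrow> real) \<Rightarrow> (real \<Rightarrow> real^'n \<Rightarrow> real) \<Rightarrow> nat \<Rightarrow> (real \<times> (real^'n)) set" where
  "phase_region m U u i =
     {(t, x) \<in> stefan_domain. U i < u t x \<and> (i < m \<longrightarrow> u t x < U (Suc i))}"

definition transition_surface ::
    "(nat \<Rightarrow> real) \<Rightarrow> (real \<Rightarrow> real^'n \<Rightarrow> real) \<Rightarrow> nat \<Rightarrow> (real \<times> (real^'n)) set" where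
  "transition_surface U u i = {(t, x) \<in> stefan_domain. u t x = U i}"

(* Classical (C^{1,2}) solution of u_t = c * Laplacian u on an open set; H is the
   spatial Hessian (as a linear map) and its trace is the Laplacian. *)
definition heat_solution_on ::
    "(real \<times> (real^'n)) set \<Rightarrow> real \<Rightarrow> (real \<Rightarrow> real^'n \<Rightarrow> real) \<Rightarrow> bool" where
  "heat_solution_on W c u \<longleftrightarrow>
     (\<exists>(ut :: real \<times> (real^'n) \<Rightarrow> real) (H :: real \<times> (real^'n) \<Rightarrow> real^'n \<Rightarrow> real^'n).
        open W \<and> continuous_on W ut \<and> continuous_on W (grad_x u) \<and>
        (\<forall>h. continuous_on W (\<lambda>q. H q h)) \<and>
        (\<forall>t x. (t, x) \<in> W \<longrightarrow>
           ((\<lambda>s. u s x) has_real_derivative ut (t, x)) (at t) \<and>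
           (GDERIV (u t) x :> grad_x u (t, x)) \<and>
           ((\<lambda>y. grad_x u (t, y)) has_derivative H (t, x)) (at x) \<and>
           ut (t, x) = c * (\<Sum>j\<in>UNIV. H (t, x) (axis j 1) $ j)))"

definition C1_hypersurface :: "'a::euclidean_space set \<Rightarrow> bool" where
  "C1_hypersurface S \<longleftrightarrow>
     (\<forall>p\<in>S. \<exists>W (\<phi> :: 'a \<Rightarrow> real) g. open W \<and> p \<in> W \<and> continuous_on W g \<and>
        (\<forall>q\<in>W. (GDERIV \<phi> q :> g q) \<and> g q \<noteq> 0) \<and>
        S \<inter> W = {q \<in> W. \<phi> q = 0})"

(* Nonzero and orthogonal to the velocity at p of every curve that runs in S. *)
definition normal_vector :: "'a::euclidean_space set \<Rightarrow> 'a \<Rightarrow> 'a \<Rightarrow> bool" where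
  "normal_vector S p \<nu> \<longleftrightarrow> \<nu> \<noteq> 0 \<and>
     (\<forall>(\<gamma> :: real \<Rightarrow> 'a) w. \<gamma> 0 = p \<longrightarrow> (\<forall>\<^sub>F s in nhds 0. \<gamma> s \<in> S) \<longrightarrow>
        (\<gamma> has_vector_derivative w) (at 0) \<longrightarrow> w \<bullet> \<nu> = 0)"

definition directed_normal ::
    "'a::euclidean_space set \<Rightarrow> 'a set \<Rightarrow> 'a set \<Rightarrow> 'a \<Rightarrow> 'a \<Rightarrow> bool" where
  "directed_normal S Wm Wp p \<nu> \<longleftrightarrow> normal_vector S p \<nu> \<and>
     (\<forall>\<^sub>F s in at_right 0. p + s *\<^sub>R \<nu> \<in> Wp \<and> p - s *\<^sub>R \<nu> \<in> Wm)"

(* The existence of a directed normal at every point is demanded explicitly: without it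
   the condition on all directed normals could hold vacuously. *)
definition stefan_condition ::
    "nat \<Rightarrow> (nat \<Rightarrow> real) \<Rightarrow> (nat \<Rightarrow> real) \<Rightarrow> (nat \<Rightarrow> real) \<Rightarrow>
      (real \<Rightarrow> real^'n \<Rightarrow> real) \<Rightarrow> nat \<Rightarrow> bool" where
  "stefan_condition m U k d u i \<longleftrightarrow>
     (let S = transition_surface U u i;
          Wm = phase_region m U u (i - 1);
          Wp = phase_region m U u i
      in C1_hypersurface S \<and>
         (\<forall>p\<in>S. (\<exists>\<nu>. directed_normal S Wm Wp p \<nu>) \<and>
            (\<exists>gm gp. (grad_x u \<longlongrightarrow> gm) (at p within Wm) \<and> (grad_x u \<longlongrightarrow> gp) (at p within Wp) \<and>
               (\<forall>\<nu>t \<nu>x. directed_normal S Wm Wp p (\<nu>t, \<nu>x) \<longrightarrow>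
                  - d i * \<nu>t + (k i *\<^sub>R gp - k (i - 1) *\<^sub>R gm) \<bullet> \<nu>x = 0))))"

definition stefan_solution ::
    "nat \<Rightarrow> (nat \<Rightarrow> real) \<Rightarrow> (nat \<Rightarrow> real) \<Rightarrow> (nat \<Rightarrow> real) \<Rightarrow> (nat \<Rightarrow> real) \<Rightarrow> real \<Rightarrow>
      (real \<Rightarrow> real^'n \<Rightarrow> real) \<Rightarrow> bool" where
  "stefan_solution m U a k d A u \<longleftrightarrow>
     continuous_on stefan_domain (\<lambda>(t, x). u t x) \<and>
     (\<forall>i\<le>m. heat_solution_on (phase_region m U u i) ((a i)\<^sup>2) u) \<and>
     (\<forall>i\<in>{1..m}. stefan_condition m U k d u i) \<and>
     (\<forall>x. x \<noteq> 0 \<longrightarrow> ((\<lambda>t. u t x) \<longlongrightarrow> U 0) (at_right 0)) \<and>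
     (\<forall>t>0. (\<lambda>x. u t x) \<sim>[at 0] (\<lambda>x. A * stefan_E CARD('n) (norm x / (a m * sqrt t))))"

(* xi 0 = \<infinity> is allowed, hence the extended real arguments of stefan_G;
   xi i is finite for 1 \<le> i \<le> m. *)
definition stefan_profile ::
    "nat \<Rightarrow> nat \<Rightarrow> (nat \<Rightarrow> real) \<Rightarrow> (nat \<Rightarrow> real) \<Rightarrow> real \<Rightarrow> (nat \<Rightarrow> ereal) \<Rightarrow> (real \<Rightarrow> real) \<Rightarrow> bool" where
  "stefan_profile n m U a A \<xi> v \<longleftrightarrow>
     (\<forall>r. 0 < r \<longrightarrow> ereal r < \<xi> m \<longrightarrow>
        v r = U m + A * (stefan_G n (ereal (r / a m)) - stefan_G n (\<xi> m / ereal (a m)))) \<and>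
     (\<forall>i<m. \<forall>r. \<xi> (Suc i) < ereal r \<longrightarrow> ereal r < \<xi> i \<longrightarrow>
        v r = U i + (U (Suc i) - U i) *
                (stefan_G n (ereal (r / a i)) - stefan_G n (\<xi> i / ereal (a i))) /
                (stefan_G n (\<xi> (Suc i) / ereal (a i)) - stefan_G n (\<xi> i / ereal (a i)))) \<and>
     (\<forall>i\<in>{1..m}. v (real_of_ereal (\<xi> i)) = U i)"

end

theory Submission
  imports Defs
begin

text \<open>
  In phase \<open>i\<close> the profile has the form \<open>v r = U i + c i * (G (r / a i) - G (\<xi> i / a i))\<close>, so that the
  temperature at \<open>\<xi> (i + 1)\<close> and the Stefan condition there determine \<open>\<xi> (i + 1)\<close> and \<open>c (i + 1)\<close> from \<open>\<xi> i\<close>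
  and \<open>c i\<close>; both equations are always solvable because G decreases from \<open>\<infinity>\<close> to 0 and because every
  term in the Stefan condition has a sign. Starting with an arbitrary \<open>\<xi> 1 = s > 0\<close> one thus ends with a
  continuous function \<open>c m\<close> of \<open>s\<close>. It tends to 0 as \<open>s \<rightarrow> 0\<close> and to \<open>\<infinity>\<close> as \<open>s \<rightarrow> \<infinity>\<close>, so by the
  intermediate value theorem it takes the value \<open>A\<close>.
\<close>

section \<open>The function G\<close>

text \<open>The divergence of \<open>c m\<close> for large s is the delicate limit. Since
  \<open>d i = 0\<close> is allowed, latent heat cannot be relied on, and for
  \<open>a j < a (j + 1)\<close> the ratio of the flux factors of the two phases decays like a
  Gaussian, so that growth of \<open>c j\<close> alone says nothing about \<open>c (j + 1)\<close>.
  The remedy is the tail bound y G(y) \<le> 2 g(y) with g = - G'. The temperature drop across phase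
  j fixes \<open>c j\<close> times a difference of values of G, and the bound turns this into a heat
  flux at the front of at least a constant times \<xi> (j + 1), whatever the outer phases do.
  Division by the flux factor of phase j + 1, which tends to 0, then gives divergence. Near s = 0
  the singular powers in the ratio cancel and a finite limit remains, so smallness passes from phase
  to phase.

  The phases of a solution are defined by temperature and not by |x| / sqrt t. Strict monotonicity
  of the profile is what translates one into the other.\<close>

definition stefan_g :: "nat \<Rightarrow> real \<Rightarrow> real" where
  "stefan_g n s = exp (- (s ^ 2) / 4) / s ^ (n - 1)"

lemma stefan_G_eq:
  assumes "n \<ge> 1"
  shows "stefan_G n y = (LBINT s=y..\<infinity>. stefan_g n s)"
proof -
  have "s powi (1 - int n) = 1 / s ^ (n - 1)" for s :: real
    using assms by (simp add: power_int_def field_simps of_nat_diff nat_diff_distrib)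
  then show ?thesis
    by (simp add: stefan_G_def stefan_g_def)
qed

lemma stefan_G_infinity [simp]: "stefan_G n \<infinity> = 0"
  by (simp add: stefan_G_def interval_integral_endpoints_same)

lemma stefan_g_pos: "0 < s \<Longrightarrow> 0 < stefan_g n s"
  by (simp add: stefan_g_def)

lemma has_real_derivative_stefan_g:
  assumes "s \<noteq> 0" "n \<ge> 1"
  shows "(stefan_g n has_real_derivative (- (real n - 1) / s - s / 2) * stefan_g n s) (at s)"
proof -
  obtain p where n: "n = Suc p" using assms by (cases n) auto
  have *: "s ^ p / s = s ^ (p - Suc 0)" if "p \<noteq> 0" for p
    using that assms by (cases p) auto
  show ?thesis
    unfolding stefan_g_def n
    by (rule derivative_eq_intros refl | use assms in \<open>simp; fail\<close>)+
       (cases p; use assms in \<open>simp add: field_simps power2_eq_square\<close>)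
qed

lemma continuous_on_stefan_g: "continuous_on {0<..} (stefan_g n)"
  unfolding stefan_g_def by (intro continuous_intros) auto

text \<open>For s > y the factor 1 / s^(n - 1) is at most s / y^n, and s * exp (- s^2 / 4) has the
  primitive -2 * exp (- s^2 / 4). This one comparison yields both integrability at infinity and the
  tail bound.\<close>

lemma stefan_g_tail:
  assumes "n \<ge> 1" "0 < y"
  shows set_integrable_stefan_g: "set_integrable lborel {y<..} (stefan_g n)"
    and stefan_G_le: "y * stefan_G n (ereal y) \<le> 2 * stefan_g n y"
proof -
  let ?F = "\<lambda>s::real. - 2 / y ^ n * exp (- (s\<^sup>2) / 4)"
  let ?f = "\<lambda>s::real. s / y ^ n * exp (- (s\<^sup>2) / 4)"
  have der: "DERIV ?F x :> ?f x" for x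
    by (rule derivative_eq_intros refl | simp)+
  have lim: "((?F \<circ> real_of_ereal) \<longlongrightarrow> 0) (at_left \<infinity>)"
  proof -
    have "(?F \<longlongrightarrow> - 2 / y ^ n * 0) at_top"
    proof (rule tendsto_mult_left, rule filterlim_compose[OF exp_at_bot])
      show "LIM x at_top. - (x\<^sup>2) / 4 :> (at_bot :: real filter)"
        by (rule filterlim_at_bot_mono[OF filterlim_uminus_at_bot_at_top])
           (intro eventually_at_top_linorderI[of 4], simp add: power2_eq_square)
    qed
    then show ?thesis
      unfolding ereal_tendsto_simps by simp
  qed
  have lim2: "((?F \<circ> real_of_ereal) \<longlongrightarrow> ?F y) (at_right (ereal y))"
    by (simp only: ereal_tendsto_simps) (intro tendsto_intros; simp)
  have nonneg: "AE x in lborel. ereal y < ereal x \<longrightarrow> ereal x < \<infinity> \<longrightarrow> 0 \<le> ?f x"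
    using assms by auto
  have *: "set_integrable lborel (einterval (ereal y) \<infinity>) ?f" "(LBINT x=ereal y..\<infinity>. ?f x) = 0 - ?F y"
    by (rule interval_integral_FTC_nonneg[OF _ der _ nonneg lim2 lim];
        use assms in \<open>auto intro!: continuous_intros\<close>)+
  have int: "set_integrable lborel {y<..} ?f"
    using * by (simp add: einterval_eq)
  have le: "stefan_g n s \<le> ?f s" "0 \<le> stefan_g n s" if "y < s" for s
  proof -
    have s: "0 < s" using that assms by linarith
    have "y ^ n \<le> s ^ n" using that assms by (intro power_mono) auto
    moreover have "s ^ n = s * s ^ (n - 1)" using assms by (cases n) auto
    ultimately have "1 / s ^ (n - 1) \<le> s / y ^ n"
      using s assms by (simp add: field_simps)
    from mult_left_mono[OF this, of "exp (- (s\<^sup>2) / 4)"]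
    show "stefan_g n s \<le> ?f s" by (simp add: stefan_g_def mult_ac)
    show "0 \<le> stefan_g n s" using s by (simp add: stefan_g_def)
  qed
  show *: "set_integrable lborel {y<..} (stefan_g n)"
  proof (rule set_integrable_bound[OF int])
    show "set_borel_measurable lborel {y<..} (stefan_g n)"
      unfolding set_borel_measurable_def measurable_lborel2
      by (intro borel_measurable_continuous_on_indicator continuous_on_subset[OF continuous_on_stefan_g])
         (use assms in \<open>auto; fail\<close>)+
    show "AE x in lborel. x \<in> {y<..} \<longrightarrow> norm (stefan_g n x) \<le> norm (?f x)"
    proof (intro AE_I2 impI)
      fix x assume "x \<in> {y<..}"
      then have "y < x" by simp
      from le[OF this] have "norm (stefan_g n x) \<le> ?f x" by simp
      also have "?f x \<le> norm (?f x)" by (simp only: real_norm_def abs_ge_self)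
      finally show "norm (stefan_g n x) \<le> norm (?f x)" .
    qed
  qed
  have "stefan_G n (ereal y) \<le> (LBINT x=ereal y..\<infinity>. ?f x)"
    unfolding stefan_G_eq[OF assms(1)] interval_integral_to_infinity_eq
    by (rule set_integral_mono[OF * int]) (use le in auto)
  also have "\<dots> = 2 / y ^ n * exp (- (y\<^sup>2) / 4)"
    using \<open>(LBINT x=ereal y..\<infinity>. ?f x) = 0 - ?F y\<close> by simp
  finally have "y * stefan_G n (ereal y) \<le> y * (2 / y ^ n * exp (- (y\<^sup>2) / 4))"
    using assms by (intro mult_left_mono) auto
  also have "y * (2 / y ^ n * exp (- (y\<^sup>2) / 4)) = 2 * stefan_g n y"
    using assms by (cases n) (auto simp: stefan_g_def)
  finally show "y * stefan_G n (ereal y) \<le> 2 * stefan_g n y" .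
qed

text \<open>The integral is oriented, so either order of \<open>x\<close> and \<open>y\<close> is
  covered. This is what allows G to be differentiated from both sides.\<close>

lemma stefan_G_diff:
  assumes "n \<ge> 1" "0 < x" "0 < y"
  shows "stefan_G n (ereal y) = stefan_G n (ereal x) - (LBINT s=ereal x..ereal y. stefan_g n s)"
proof -
  have "(LBINT s=ereal x..ereal y. stefan_g n s) + (LBINT s=ereal y..\<infinity>. stefan_g n s)
      = (LBINT s=ereal x..\<infinity>. stefan_g n s)"
  proof (rule interval_integral_sum)
    show "interval_lebesgue_integrable lborel (min (ereal x) (min (ereal y) \<infinity>))
            (max (ereal x) (max (ereal y) \<infinity>)) (stefan_g n)"
      using set_integrable_stefan_g[of n x] set_integrable_stefan_g[of n y] assms
      by (auto simp: interval_integrable_to_infinity_eq max_def min_def)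
  qed
  then show ?thesis by (simp add: stefan_G_eq[OF assms(1)])
qed

lemma has_real_derivative_stefan_G:
  assumes "n \<ge> 1" "0 < y"
  shows "((\<lambda>y. stefan_G n (ereal y)) has_real_derivative - stefan_g n y) (at y)"
proof -
  \<comment> \<open>The integrand is singular at 0, so the fundamental theorem is applied on a
    compact interval in {0<..} with y in its interior.\<close>
  have "((\<lambda>u. LBINT s=ereal y..ereal u. stefan_g n s) has_vector_derivative stefan_g n y)
          (at y within {y/2..2*y})"
    by (rule interval_integral_FTC2)
       (use assms in \<open>auto intro!: continuous_on_subset[OF continuous_on_stefan_g]\<close>)
  then have "((\<lambda>u. LBINT s=ereal y..ereal u. stefan_g n s) has_real_derivative stefan_g n y) (at y)"
    using assms at_within_interior[of y "{y/2..2*y}"]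
    by (simp add: has_real_derivative_iff_has_vector_derivative)
  then have "((\<lambda>u. stefan_G n (ereal y) - (LBINT s=ereal y..ereal u. stefan_g n s))
      has_real_derivative - stefan_g n y) (at y)"
    by (auto intro!: derivative_eq_intros)
  then show ?thesis
  proof (rule has_field_derivative_transform_within_open)
    show "stefan_G n (ereal y) - (LBINT s=ereal y..ereal u. stefan_g n s) = stefan_G n (ereal u)"
      if "u \<in> {0<..}" for u
      using stefan_G_diff[of n y u] that assms by simp
  qed (use assms in auto)
qed

lemma continuous_on_stefan_G:
  assumes "n \<ge> 1"
  shows "continuous_on {0<..} (\<lambda>y. stefan_G n (ereal y))"
  using has_real_derivative_stefan_G[OF assms] DERIV_isCont
  by (intro continuous_at_imp_continuous_on) fastforce

lemma stefan_G_strict_antimono: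
  assumes "n \<ge> 1" "0 < x" "x < y"
  shows "stefan_G n (ereal y) < stefan_G n (ereal x)"
proof (rule DERIV_neg_imp_decreasing[OF assms(3)])
  fix z assume "x \<le> z" "z \<le> y"
  then show "\<exists>l. DERIV (\<lambda>y. stefan_G n (ereal y)) z :> l \<and> l < 0"
    using has_real_derivative_stefan_G[of n z] stefan_g_pos[of z n] assms
    by (intro exI[of _ "- stefan_g n z"]) auto
qed

lemma stefan_G_nonneg: "n \<ge> 1 \<Longrightarrow> 0 < y \<Longrightarrow> 0 \<le> stefan_G n (ereal y)"
  unfolding stefan_G_eq interval_integral_to_infinity_eq set_lebesgue_integral_def
  by (intro integral_nonneg_AE AE_I2) (auto simp: stefan_g_def indicator_def)

lemma stefan_G_pos: "n \<ge> 1 \<Longrightarrow> 0 < y \<Longrightarrow> 0 < stefan_G n (ereal y)"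
  using stefan_G_strict_antimono[of n y "y + 1"] stefan_G_nonneg[of n "y + 1"] by simp

lemma stefan_g_tendsto_0:
  assumes "n \<ge> 2"
  shows "(stefan_g n \<longlongrightarrow> 0) at_top"
proof (rule tendsto_sandwich[OF _ _ tendsto_const])
  show "\<forall>\<^sub>F s in at_top. 0 \<le> stefan_g n s"
    by (intro eventually_at_top_linorderI[of 0]) (auto simp: stefan_g_def)
  show "\<forall>\<^sub>F s in at_top. stefan_g n s \<le> inverse s"
  proof (intro eventually_at_top_linorderI[of 1])
    fix s :: real assume s: "1 \<le> s"
    then have "exp (- (s\<^sup>2) / 4) \<le> 1" by simp
    moreover have "s ^ 1 \<le> s ^ (n - 1)" using s assms by (intro power_increasing) auto
    ultimately show "stefan_g n s \<le> inverse s"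
      unfolding stefan_g_def inverse_eq_divide using s by (intro frac_le) auto
  qed
qed (rule tendsto_inverse_0_at_top[OF filterlim_ident])

lemma stefan_G_tendsto_0:
  assumes "n \<ge> 2"
  shows "((\<lambda>y. stefan_G n (ereal y)) \<longlongrightarrow> 0) at_top"
proof (rule tendsto_sandwich[OF _ _ tendsto_const])
  show "\<forall>\<^sub>F s in at_top. 0 \<le> stefan_G n (ereal s)"
    using assms by (intro eventually_at_top_linorderI[of 1]) (auto intro!: stefan_G_nonneg)
  show "\<forall>\<^sub>F s in at_top. stefan_G n (ereal s) \<le> 2 * stefan_g n s"
  proof (intro eventually_at_top_linorderI[of 1])
    fix s :: real assume s: "1 \<le> s"
    have "1 * stefan_G n (ereal s) \<le> s * stefan_G n (ereal s)"
      using s assms by (intro mult_right_mono stefan_G_nonneg) auto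
    with stefan_G_le[of n s] s assms show "stefan_G n (ereal s) \<le> 2 * stefan_g n s"
      by simp
  qed
  show "((\<lambda>s. 2 * stefan_g n s) \<longlongrightarrow> 0) at_top"
    using tendsto_mult_left[OF stefan_g_tendsto_0[OF assms], of 2] by simp
qed

section \<open>Singularity of G at 0: comparison with the fundamental solution\<close>

lemma stefan_E_at_top:
  assumes "n \<ge> 2"
  shows "filterlim (stefan_E n) at_top (at_right 0)"
proof (cases "n = 2")
  case True
  then show ?thesis
    using ln_at_0 by (simp add: stefan_E_def[abs_def] filterlim_uminus_at_top)
next
  case False
  have "((\<lambda>y::real. (real n - 2) * y ^ (n - 2)) \<longlongrightarrow> (real n - 2) * 0 ^ (n - 2)) (at_right 0)"
    by (intro tendsto_intros)
  moreover have "\<forall>\<^sub>F y::real in at_right 0. 0 < (real n - 2) * y ^ (n - 2)"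
    using eventually_at_right_less[of 0] by eventually_elim (use assms False in auto)
  ultimately have "filterlim (\<lambda>y::real. inverse ((real n - 2) * y ^ (n - 2))) at_top (at_right 0)"
    using False assms by (intro filterlim_inverse_at_top) (auto simp: power_0_left)
  then show ?thesis using False by (simp add: stefan_E_def[abs_def] inverse_eq_divide)
qed

lemma has_real_derivative_stefan_E:
  assumes "n \<ge> 2" "0 < y"
  shows "(stefan_E n has_real_derivative - (1 / y ^ (n - 1))) (at y)"
proof (cases "n = 2")
  case True
  then show ?thesis using assms
    by (auto simp: stefan_E_def[abs_def] intro!: derivative_eq_intros)
next
  case False
  then obtain p where n: "n = Suc (Suc (Suc p))"
    using assms by (metis Suc_1 Suc_le_D le_antisym not_less_eq_eq numeral_2_eq_2)
  have "y * y ^ (p - 1) = y ^ p" if "p \<noteq> 0"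
    using that by (cases p) auto
  then show ?thesis using assms unfolding n stefan_E_def
    by (auto intro!: derivative_eq_intros simp: divide_simps power2_eq_square)
      (cases p; simp add: algebra_simps)
qed

text \<open>The quotient of the derivatives is exp (- y^2 / 4), and l'Hopital's rule only asks that
  the denominator diverge, so both forms of \<open>stefan_E\<close> are treated alike. The limit
  serves twice: it makes G diverge at 0, and it gives the growth condition of the solution as x
  tends to 0.\<close>

lemma stefan_G_over_E:
  assumes "n \<ge> 2"
  shows "((\<lambda>y. stefan_G n (ereal y) / stefan_E n y) \<longlongrightarrow> 1) (at_right 0)"
proof (rule lhopital_right_0_at_top[OF stefan_E_at_top[OF assms]])
  have ev: "\<forall>\<^sub>F y in at_right 0. 0 < (y::real)"
    using eventually_at_right_less[of 0] .
  show "\<forall>\<^sub>F y in at_right 0. - (1 / y ^ (n - 1)) \<noteq> (0::real)"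
    using ev by eventually_elim auto
  show "\<forall>\<^sub>F y in at_right 0. DERIV (\<lambda>y. stefan_G n (ereal y)) y :> - stefan_g n y"
    using ev by eventually_elim (use has_real_derivative_stefan_G assms in auto)
  show "\<forall>\<^sub>F y in at_right 0. DERIV (stefan_E n) y :> - (1 / y ^ (n - 1))"
    using ev by eventually_elim (use has_real_derivative_stefan_E assms in auto)
  have "((\<lambda>y::real. exp (- (y\<^sup>2) / 4)) \<longlongrightarrow> exp (- (0\<^sup>2) / 4)) (at_right 0)"
    by (intro tendsto_intros) auto
  then have lim: "((\<lambda>y::real. exp (- (y\<^sup>2) / 4)) \<longlongrightarrow> 1) (at_right 0)"
    by simp
  show "((\<lambda>y. - stefan_g n y / - (1 / y ^ (n - 1))) \<longlongrightarrow> 1) (at_right 0)"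
  proof (rule Lim_transform_eventually[OF lim])
    show "\<forall>\<^sub>F y in at_right 0. exp (- (y\<^sup>2) / 4) = - stefan_g n y / - (1 / y ^ (n - 1))"
      using ev by eventually_elim (auto simp: stefan_g_def)
  qed
qed

lemma stefan_G_at_top:
  assumes "n \<ge> 2"
  shows "filterlim (\<lambda>y. stefan_G n (ereal y)) at_top (at_right 0)"
proof -
  have "filterlim (\<lambda>y. stefan_G n (ereal y) / stefan_E n y * stefan_E n y) at_top (at_right 0)"
    by (rule filterlim_tendsto_pos_mult_at_top[OF stefan_G_over_E _ stefan_E_at_top]) (use assms in auto)
  moreover have "\<forall>\<^sub>F y in at_right 0. stefan_E n y > 0"
    using stefan_E_at_top[OF assms] by (auto simp: filterlim_at_top_dense)
  then have "\<forall>\<^sub>F y in at_right 0. stefan_G n (ereal y) / stefan_E n y * stefan_E n y = stefan_G n (ereal y)"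
    by eventually_elim auto
  ultimately show ?thesis by (rule filterlim_mono_eventually[OF _ order_refl order_refl])
qed

section \<open>Shooting for the phase fronts\<close>

text \<open>Meaningful only for z > 0, which is the range of G on the positive reals.\<close>

definition stefan_G_inv :: "nat \<Rightarrow> real \<Rightarrow> real" where
  "stefan_G_inv n z = (THE y. 0 < y \<and> stefan_G n (ereal y) = z)"

lemma stefan_G_less_iff:
  assumes "n \<ge> 1" "0 < x" "0 < y"
  shows "stefan_G n (ereal x) < stefan_G n (ereal y) \<longleftrightarrow> y < x"
  using stefan_G_strict_antimono[of n x y] stefan_G_strict_antimono[of n y x] assms
  by (cases x y rule: linorder_cases) auto

lemma stefan_G_inv_stefan_G:
  assumes "n \<ge> 1" "0 < y"
  shows "stefan_G_inv n (stefan_G n (ereal y)) = y"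
  unfolding stefan_G_inv_def
proof (rule the_equality)
  show "x = y" if "0 < x \<and> stefan_G n (ereal x) = stefan_G n (ereal y)" for x
    using that stefan_G_less_iff[of n x y] stefan_G_less_iff[of n y x] assms by auto
qed (use assms in auto)

lemma stefan_G_surj:
  assumes "n \<ge> 2" "0 < z"
  obtains y where "0 < y" "stefan_G n (ereal y) = z"
proof -
  have "\<forall>\<^sub>F y in at_right 0. 0 < y \<and> z < stefan_G n (ereal y)"
    using stefan_G_at_top[OF assms(1)] eventually_at_right_less[of "0::real"]
    by (auto simp: filterlim_at_top_dense eventually_conj_iff)
  then obtain l where l: "0 < l" "z < stefan_G n (ereal l)"
    using eventually_happens'[OF trivial_limit_at_right_real] by blast
  have "\<forall>\<^sub>F y in at_top. l < y \<and> stefan_G n (ereal y) < z"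
    using order_tendstoD(2)[OF stefan_G_tendsto_0 assms(2)] eventually_gt_at_top[of l] assms
    by (auto simp: eventually_conj_iff)
  then obtain u where u: "l < u" "stefan_G n (ereal u) < z"
    using eventually_happens'[OF trivial_limit_at_top_linorder] by blast
  have "\<exists>y. l \<le> y \<and> y \<le> u \<and> stefan_G n (ereal y) = z"
    by (rule IVT2')
       (use l u assms in \<open>auto intro!: continuous_on_subset[OF continuous_on_stefan_G]\<close>)
  then show thesis using that order.strict_trans2[OF l(1)] by blast
qed

lemma stefan_G_inv:
  assumes "n \<ge> 2" "0 < z"
  shows "0 < stefan_G_inv n z" "stefan_G n (ereal (stefan_G_inv n z)) = z"
  using stefan_G_surj[OF assms] stefan_G_inv_stefan_G[of n] assms by fastforce+

lemma continuous_on_stefan_G_inv: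
  assumes "n \<ge> 2"
  shows "continuous_on {0<..} (stefan_G_inv n)"
proof (intro continuous_at_imp_continuous_on ballI)
  fix z :: real assume "z \<in> {0<..}"
  then obtain y where y: "0 < y" "stefan_G n (ereal y) = z"
    using stefan_G_surj[OF assms] by auto
  have "isCont (stefan_G_inv n) (stefan_G n (ereal y))"
  proof (rule isCont_inverse_function2[where f = "\<lambda>y. stefan_G n (ereal y)" and a = "y / 2" and b = "2 * y"])
    show "isCont (\<lambda>y. stefan_G n (ereal y)) x" if "y / 2 \<le> x" for x
      using DERIV_isCont[OF has_real_derivative_stefan_G[of n x]] that y assms by auto
  qed (use y assms in \<open>auto intro!: stefan_G_inv_stefan_G\<close>)
  then show "isCont (stefan_G_inv n) z" using y by simp
qed

text \<open>The shooting involves only one real variable, so the dimension is a mere number here; it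
  is tied to \<open>CARD('n)\<close> when the profile is placed in space.\<close>

locale stefan_data =
  fixes n m :: nat and U a k d :: "nat \<Rightarrow> real"
  assumes n: "n \<ge> 2"
    and U_less: "\<And>i. i < m \<Longrightarrow> U i < U (Suc i)"
    and a_pos: "\<And>i. i \<le> m \<Longrightarrow> a i > 0"
    and k_pos: "\<And>i. i \<le> m \<Longrightarrow> k i > 0"
    and d_nonneg: "\<And>i. 1 \<le> i \<Longrightarrow> i \<le> m \<Longrightarrow> d i \<ge> 0"
begin

section \<open>The rescaled kernels of the phases and their limits\<close>

definition H :: "nat \<Rightarrow> real \<Rightarrow> real" where
  "H i r = stefan_G n (ereal (r / a i))"

definition h :: "nat \<Rightarrow> real \<Rightarrow> real" where
  "h i r = stefan_g n (r / a i) / a i"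

lemma n1: "n \<ge> 1" using n by simp

lemma h_pos: "i \<le> m \<Longrightarrow> 0 < r \<Longrightarrow> 0 < h i r"
  using a_pos by (simp add: h_def stefan_g_pos)

lemma H_pos: "i \<le> m \<Longrightarrow> 0 < r \<Longrightarrow> 0 < H i r"
  using a_pos n by (simp add: H_def stefan_G_pos)

lemma H_less_iff: "i \<le> m \<Longrightarrow> 0 < x \<Longrightarrow> 0 < y \<Longrightarrow> H i x < H i y \<longleftrightarrow> y < x"
  using a_pos[of i] n by (simp add: H_def stefan_G_less_iff divide_less_cancel)

lemma has_real_derivative_H:
  assumes "i \<le> m" "0 < r"
  shows "(H i has_real_derivative - h i r) (at r)"
proof -
  have "((\<lambda>r. stefan_G n (ereal (r / a i))) has_real_derivative - stefan_g n (r / a i) * (1 / a i)) (at r)"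
    by (rule DERIV_chain'[OF _ has_real_derivative_stefan_G[OF n1]])
       (use assms a_pos[of i] in \<open>auto intro!: derivative_eq_intros\<close>)
  then show ?thesis by (simp add: H_def[abs_def] h_def)
qed

lemma continuous_on_H: "i \<le> m \<Longrightarrow> continuous_on {0<..} (H i)"
  using has_real_derivative_H DERIV_isCont by (intro continuous_at_imp_continuous_on) fastforce

lemma continuous_on_h: "i \<le> m \<Longrightarrow> continuous_on {0<..} (h i)"
  unfolding h_def using a_pos
  by (intro continuous_intros continuous_on_compose2[OF continuous_on_stefan_g[of n]]) force+

lemma H_le: "i \<le> m \<Longrightarrow> 0 < r \<Longrightarrow> r * H i r \<le> 2 * (a i)\<^sup>2 * h i r"
  using stefan_G_le[of n "r / a i"] n a_pos[of i]
  by (simp add: H_def h_def power2_eq_square field_simps)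

lemma H_at_top:
  assumes "i \<le> m"
  shows "(H i \<longlongrightarrow> 0) at_top"
  unfolding H_def
  by (rule filterlim_compose[OF stefan_G_tendsto_0[OF n]])
     (use a_pos[OF assms] in \<open>auto intro!: filterlim_tendsto_pos_mult_at_top[OF tendsto_const _ filterlim_ident, of "1 / a i", simplified]\<close>)

lemma h_at_top:
  assumes "i \<le> m"
  shows "(h i \<longlongrightarrow> 0) at_top"
proof -
  have "((\<lambda>r. stefan_g n (r / a i)) \<longlongrightarrow> 0) at_top"
    by (rule filterlim_compose[OF stefan_g_tendsto_0[OF n]])
       (use a_pos[OF assms] in \<open>auto intro!: filterlim_tendsto_pos_mult_at_top[OF tendsto_const _ filterlim_ident, of "1 / a i", simplified]\<close>)
  from tendsto_divide[OF this tendsto_const[of "a i"]] a_pos[OF assms]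
  show ?thesis by (simp add: h_def[abs_def])
qed

text \<open>Near 0 the kernel \<open>h i r\<close> is of order r^(1 - n), so the quotient is of
  order r^n. This disposes of the latent heat term for small fronts.\<close>

lemma id_over_h_tendsto_0:
  assumes "i \<le> m"
  shows "((\<lambda>r. r / h i r) \<longlongrightarrow> 0) (at_right 0)"
proof -
  have "((\<lambda>r. r * (r / a i) ^ (n - 1) * a i / exp (- ((r / a i)\<^sup>2) / 4)) \<longlongrightarrow> 0) (at_right 0)"
    by (rule tendsto_eq_intros refl | use a_pos[OF assms] in force)+
  then show ?thesis by (simp add: h_def stefan_g_def mult.assoc)
qed

text \<open>The powers of r cancel. What is left is a constant in \<open>a i\<close> and
  \<open>a j\<close> times a quotient of two Gaussians that both tend to 1.\<close>

lemma h_ratio_convergent: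
  assumes "i \<le> m" "j \<le> m"
  shows "\<exists>L. ((\<lambda>r. h i r / h j r) \<longlongrightarrow> L) (at_right 0)"
proof
  let ?C = "(a i / a j) ^ (n - 1) * (a j / a i)"
  let ?f = "\<lambda>r. ?C * (exp (- ((r / a i)\<^sup>2) / 4) / exp (- ((r / a j)\<^sup>2) / 4))"
  have lim: "(?f \<longlongrightarrow> ?C) (at_right 0)"
    by (rule tendsto_eq_intros refl | use a_pos[OF assms(1)] a_pos[OF assms(2)] in force)+
  show "((\<lambda>r. h i r / h j r) \<longlongrightarrow> ?C) (at_right 0)"
  proof (rule Lim_transform_eventually[OF lim])
    show "\<forall>\<^sub>F r in at_right 0. ?f r = h i r / h j r"
      using eventually_at_right_less[of 0]
      by eventually_elim
         (use a_pos[OF assms(1)] a_pos[OF assms(2)] in \<open>simp add: h_def stefan_g_def power_divide mult_ac\<close>)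
  qed
qed

text \<open>
  The state after \<open>j\<close> steps of the shooting is \<open>(\<xi> (j + 1), c j)\<close>, where the profile in
  phase \<open>j\<close> has derivative \<open>- c j * h j\<close>: the Stefan condition at \<open>\<xi> (j + 1)\<close> determines
  \<open>c (j + 1)\<close>, and the temperature drop across phase \<open>j + 1\<close> then determines \<open>\<xi> (j + 2)\<close>.
  The first component at \<open>j = m\<close> is meaningless.
\<close>
primrec shoot :: "nat \<Rightarrow> real \<Rightarrow> real \<times> real" where
  "shoot 0 s = (s, (U 1 - U 0) / H 0 s)"
| "shoot (Suc j) s =
     (let x = fst (shoot j s); c = snd (shoot j s);
          c' = (d (Suc j) * x / 2 + k j * c * h j x) / (k (Suc j) * h (Suc j) x)
      in (a (Suc j) * stefan_G_inv n (H (Suc j) x + (U (Suc (Suc j)) - U (Suc j)) / c'), c'))"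

definition "front j s = fst (shoot j s)"

definition "slope j s = snd (shoot j s)"

lemma front_0: "front 0 s = s"
  by (simp add: front_def)

lemma slope_0: "slope 0 s = (U 1 - U 0) / H 0 s"
  by (simp add: slope_def)

lemma slope_Suc: "slope (Suc j) s =
    (d (Suc j) * front j s / 2 + k j * slope j s * h j (front j s)) / (k (Suc j) * h (Suc j) (front j s))"
  by (simp add: slope_def front_def Let_def)

lemma front_Suc: "front (Suc j) s =
    a (Suc j) * stefan_G_inv n (H (Suc j) (front j s) + (U (Suc (Suc j)) - U (Suc j)) / slope (Suc j) s)"
  by (simp add: slope_def front_def Let_def)

section \<open>Signs, order of the fronts and continuity in the shooting parameter\<close>

lemma slope_Suc_pos:
  assumes "Suc j \<le> m" "0 < front j s" "0 < slope j s"
  shows "0 < slope (Suc j) s"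
  unfolding slope_Suc using assms k_pos[of j] k_pos[of "Suc j"] h_pos[of j] h_pos[of "Suc j"] d_nonneg[of "Suc j"]
  by (intro divide_pos_pos mult_pos_pos add_nonneg_pos) auto

text \<open>A positive temperature drop requires a larger value of the strictly decreasing
  \<open>H (Suc j)\<close>, hence a front further in. The condition \<open>Suc j < m\<close> ensures
  that there is a next transition temperature to reach.\<close>

lemma front_Suc_props:
  assumes "Suc j < m" "0 < front j s" "0 < slope (Suc j) s"
  shows front_Suc_pos: "0 < front (Suc j) s"
    and H_front_Suc: "H (Suc j) (front (Suc j) s) =
      H (Suc j) (front j s) + (U (Suc (Suc j)) - U (Suc j)) / slope (Suc j) s"
    and front_Suc_less: "front (Suc j) s < front j s"
proof -
  let ?z = "H (Suc j) (front j s) + (U (Suc (Suc j)) - U (Suc j)) / slope (Suc j) s"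
  have d: "0 < (U (Suc (Suc j)) - U (Suc j)) / slope (Suc j) s"
    using assms U_less by simp
  have z: "0 < ?z"
    using d H_pos[of "Suc j" "front j s"] assms by simp
  have a: "0 < a (Suc j)" using a_pos assms by simp
  show *: "0 < front (Suc j) s"
    using stefan_G_inv(1)[OF n z] a by (simp add: front_Suc)
  show H: "H (Suc j) (front (Suc j) s) = ?z"
    using stefan_G_inv(2)[OF n z] a by (simp add: front_Suc[of j] H_def[of "Suc j" "a (Suc j) * _"])
  show "front (Suc j) s < front j s"
    using H d H_less_iff[of "Suc j" "front j s" "front (Suc j) s"] assms * by simp
qed

text \<open>The two claims feed each other: \<open>slope (Suc j)\<close> needs
  \<open>front j\<close>, and \<open>front (Suc j)\<close> needs \<open>slope (Suc j)\<close>. The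
  ranges differ because the last phase has a slope but no inner front.\<close>

lemma shoot_pos:
  assumes "0 < s" "0 < m"
  shows "(j \<le> m \<longrightarrow> 0 < slope j s) \<and> (j < m \<longrightarrow> 0 < front j s)"
proof (induction j)
  case 0
  then show ?case using assms H_pos[of 0 s] U_less[of 0] by (simp add: front_0 slope_0)
next
  case (Suc j)
  then show ?case using slope_Suc_pos[of j s] front_Suc_pos[of j s] by auto
qed

lemma slope_pos: "0 < s \<Longrightarrow> 0 < m \<Longrightarrow> j \<le> m \<Longrightarrow> 0 < slope j s"
  and front_pos: "0 < s \<Longrightarrow> j < m \<Longrightarrow> 0 < front j s"
  using shoot_pos[of s j] by auto

text \<open>The case \<open>j = 0\<close> has the value 0 because the outermost phase reaches to
  \<xi> 0 = \<infinity>, where G vanishes.\<close>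

lemma slope_drop:
  assumes "0 < s" "j < m"
  shows "U (Suc j) - U j = slope j s * (H j (front j s) - (if j = 0 then 0 else H j (front (j - 1) s)))"
proof (cases j)
  case 0
  then show ?thesis using assms H_pos[of 0 s] by (simp add: front_0 slope_0)
next
  case (Suc i)
  then show ?thesis
    using assms H_front_Suc[of i s] slope_pos[of s j] front_pos[of s i] by simp
qed

lemma continuous_shoot:
  assumes "0 < m"
  shows "(j \<le> m \<longrightarrow> continuous_on {0<..} (slope j)) \<and> (j < m \<longrightarrow> continuous_on {0<..} (front j))"
proof (induction j)
  case 0
  have "H 0 s \<noteq> 0" if "0 < s" for s
    using H_pos[of 0 s] that by simp
  then show ?case
    unfolding front_0[abs_def] slope_0[abs_def]
    by (auto intro!: continuous_intros continuous_on_H)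
next
  case (Suc j)
  have 1: "continuous_on {0<..} (slope (Suc j))" if "Suc j \<le> m"
  proof -
    have "k (Suc j) * h (Suc j) (front j s) \<noteq> 0" if "0 < s" for s
      using h_pos[of "Suc j" "front j s"] k_pos[of "Suc j"] front_pos[of s j] \<open>Suc j \<le> m\<close> that by simp
    then show ?thesis
      unfolding slope_Suc[abs_def] using Suc that front_pos
      by (auto intro!: continuous_intros continuous_on_compose2[OF continuous_on_h])
  qed
  moreover have "continuous_on {0<..} (front (Suc j))" if j: "Suc j < m"
  proof -
    have "0 < H (Suc j) (front j s) + (U (Suc (Suc j)) - U (Suc j)) / slope (Suc j) s" "slope (Suc j) s \<noteq> 0"
      if "0 < s" for s
      using H_pos[of "Suc j" "front j s"] U_less[OF j] front_pos[of s j] slope_pos[of s "Suc j"] j that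
      by (auto intro!: add_pos_pos)
    then show ?thesis
      unfolding front_Suc[abs_def] using Suc j 1 front_pos
      by (auto intro!: continuous_intros continuous_on_compose2[OF continuous_on_stefan_G_inv[OF n]]
          continuous_on_compose2[OF continuous_on_H])
  qed
  ultimately show ?case by blast
qed

text \<open>\<open>slope 0\<close> vanishes because \<open>H 0\<close> diverges at 0. In the step,
  the latent heat part of \<open>slope (Suc j)\<close> is a multiple of x / h x with x =
  \<open>front j s\<close>, and the conduction part is \<open>slope j\<close> times a convergent
  ratio. The new front is squeezed between 0 and the previous one.\<close>

lemma shoot_at_0:
  assumes "0 < m"
  shows "(j \<le> m \<longrightarrow> (slope j \<longlongrightarrow> 0) (at_right 0)) \<and> (j < m \<longrightarrow> filterlim (front j) (at_right 0) (at_right 0))"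
proof (induction j)
  case 0
  have "filterlim (\<lambda>s. stefan_G n (ereal (s / a 0))) at_top (at_right 0)"
  proof (rule filterlim_compose[OF stefan_G_at_top[OF n]])
    show "filterlim (\<lambda>s. s / a 0) (at_right 0) (at_right 0)"
      unfolding filterlim_at
      using a_pos[of 0] by (auto intro!: tendsto_eq_intros eventually_at_rightI[of 0 1])
  qed
  then have "filterlim (H 0) at_top (at_right 0)"
    by (simp add: H_def[abs_def])
  from real_tendsto_divide_at_top[OF tendsto_const this]
  show ?case by (simp add: slope_0[abs_def] front_0[abs_def] filterlim_ident)
next
  case (Suc j)
  have ev: "\<forall>\<^sub>F s in at_right 0. 0 < (s::real)"
    using eventually_at_right_less[of 0] .
  have 1: "(slope (Suc j) \<longlongrightarrow> 0) (at_right 0)" if "Suc j \<le> m"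
  proof -
    obtain L where L: "((\<lambda>r. h j r / h (Suc j) r) \<longlongrightarrow> L) (at_right 0)"
      using h_ratio_convergent[of j "Suc j"] \<open>Suc j \<le> m\<close> by auto
    have x: "filterlim (front j) (at_right 0) (at_right 0)" and c: "(slope j \<longlongrightarrow> 0) (at_right 0)"
      using Suc that by auto
    have kp: "k (Suc j) > 0" using that k_pos by simp
    let ?f = "\<lambda>s. d (Suc j) / (2 * k (Suc j)) * (front j s / h (Suc j) (front j s)) +
        k j / k (Suc j) * slope j s * (h j (front j s) / h (Suc j) (front j s))"
    have "(?f \<longlongrightarrow> d (Suc j) / (2 * k (Suc j)) * 0 + k j / k (Suc j) * 0 * L) (at_right 0)"
      by (intro tendsto_intros c filterlim_compose[OF id_over_h_tendsto_0[OF that] x] filterlim_compose[OF L x])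
    moreover have "?f s = slope (Suc j) s" for s
      by (simp add: slope_Suc add_divide_distrib)
    ultimately show ?thesis by simp
  qed
  moreover have "filterlim (front (Suc j)) (at_right 0) (at_right 0)" if j: "Suc j < m"
    unfolding filterlim_at
  proof
    have *: "0 < front (Suc j) s \<and> front (Suc j) s < front j s" if "0 < s" for s
      using front_Suc_pos[of j s] front_Suc_less[of j s] front_pos[of s j] slope_pos[of s "Suc j"] j that by auto
    show "\<forall>\<^sub>F s in at_right 0. front (Suc j) s \<in> {0<..} \<and> front (Suc j) s \<noteq> 0"
      using ev by eventually_elim (use * in force)
    show "(front (Suc j) \<longlongrightarrow> 0) (at_right 0)"
    proof (rule tendsto_sandwich[OF _ _ tendsto_const])
      show "\<forall>\<^sub>F s in at_right 0. 0 \<le> front (Suc j) s"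
        using ev by eventually_elim (use * in force)
      show "\<forall>\<^sub>F s in at_right 0. front (Suc j) s \<le> front j s"
        using ev by eventually_elim (use * in force)
      show "(front j \<longlongrightarrow> 0) (at_right 0)" using Suc j by (auto simp: filterlim_at)
    qed
  qed
  ultimately show ?case by blast
qed

text \<open>Write x for \<open>front j s\<close>. The drop across phase j is at most
  \<open>slope j s * H j x\<close>, and \<open>H_le\<close> trades \<open>H j x\<close> for
  \<open>h j x / x\<close> up to the constant \<open>2 * (a j)\<^sup>2\<close>. Hence the flux
  \<open>slope j s * h j x\<close> is at least a multiple of x. The bound contains no slope of an
  outer phase and survives \<open>d (Suc j) = 0\<close>.\<close>

lemma slope_Suc_ge:
  assumes "0 < s" "Suc j \<le> m"
  shows "k j * (U (Suc j) - U j) / (2 * (a j)\<^sup>2 * k (Suc j)) * (front j s / h (Suc j) (front j s)) \<le> slope (Suc j) s"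
proof -
  define x where "x = front j s"
  have x: "0 < x" using front_pos[of s j] assms by (simp add: x_def)
  have c: "0 < slope j s" using slope_pos[of s j] assms by simp
  have kh: "0 < k (Suc j) * h (Suc j) x" using k_pos[of "Suc j"] h_pos[OF assms(2) x] assms by simp
  have a: "0 < 2 * (a j)\<^sup>2" using a_pos[of j] assms by simp
  have k: "0 < k j" using k_pos assms by simp
  have "0 \<le> (if j = 0 then 0 else H j (front (j - 1) s))"
    using H_pos[of j "front (j - 1) s"] front_pos[of s "j - 1"] assms by simp
  then have "slope j s * (H j x - (if j = 0 then 0 else H j (front (j - 1) s))) \<le> slope j s * H j x"
    using c by (intro mult_left_mono) auto
  then have "U (Suc j) - U j \<le> slope j s * H j x"
    using slope_drop[of s j] assms unfolding x_def by simp
  then have "(U (Suc j) - U j) * x \<le> slope j s * H j x * x"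
    using x by (intro mult_right_mono) auto
  also have "\<dots> = slope j s * (x * H j x)" by simp
  also have "\<dots> \<le> slope j s * (2 * (a j)\<^sup>2 * h j x)"
    using H_le[of j x] assms x c by (intro mult_left_mono) auto
  finally have "(U (Suc j) - U j) * x \<le> slope j s * h j x * (2 * (a j)\<^sup>2)"
    by (simp add: mult_ac)
  then have "(U (Suc j) - U j) * x / (2 * (a j)\<^sup>2) \<le> slope j s * h j x"
    using a by (simp only: pos_divide_le_eq)
  then have "k j * ((U (Suc j) - U j) * x / (2 * (a j)\<^sup>2)) \<le> k j * (slope j s * h j x)"
    using k by (intro mult_left_mono) auto
  also have "\<dots> \<le> d (Suc j) * x / 2 + k j * slope j s * h j x"
    using d_nonneg[of "Suc j"] assms x by simp
  finally have "k j * ((U (Suc j) - U j) * x / (2 * (a j)\<^sup>2)) / (k (Suc j) * h (Suc j) x) \<le>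
      (d (Suc j) * x / 2 + k j * slope j s * h j x) / (k (Suc j) * h (Suc j) x)"
    using kh by (intro divide_right_mono) auto
  also have "\<dots> = slope (Suc j) s" by (simp only: slope_Suc x_def)
  also have "k j * ((U (Suc j) - U j) * x / (2 * (a j)\<^sup>2)) / (k (Suc j) * h (Suc j) x) =
      k j * (U (Suc j) - U j) / (2 * (a j)\<^sup>2 * k (Suc j)) * (x / h (Suc j) x)"
    by simp
  finally show ?thesis by (simp only: x_def)
qed

text \<open>Fronts are known only through their \<open>H\<close> values. As \<open>H i\<close> is
  positive and decreasing, values tending to 0 force the argument beyond every K.\<close>

lemma front_at_top:
  assumes "i \<le> m" "((\<lambda>s. H i (f s)) \<longlongrightarrow> 0) at_top" "\<forall>\<^sub>F s in at_top. 0 < f s"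
  shows "filterlim f at_top at_top"
  unfolding filterlim_at_top_gt[where c = 0]
proof safe
  fix K :: real assume K: "0 < K"
  have "\<forall>\<^sub>F s in at_top. H i (f s) < H i K"
    using order_tendstoD(2)[OF assms(2) H_pos[OF assms(1) K]] .
  with assms(3) show "\<forall>\<^sub>F s in at_top. K \<le> f s"
    by eventually_elim (use H_less_iff[OF assms(1)] K in force)
qed

text \<open>By \<open>slope_Suc_ge\<close> the growth of \<open>slope (Suc j)\<close> comes from
  that of \<open>front j\<close> alone, so no limit of \<open>slope j\<close> enters and the claim
  on slopes can start at 1. A large slope then makes the increment of \<open>H (Suc j)\<close>
  negligible, and the next front diverges too.\<close>

lemma shoot_at_top:
  assumes "0 < m"
  shows "(j < m \<longrightarrow> filterlim (front j) at_top at_top) \<and> (0 < j \<and> j \<le> m \<longrightarrow> filterlim (slope j) at_top at_top)"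
proof (induction j)
  case 0
  show ?case by (simp add: front_0[abs_def] filterlim_ident)
next
  case (Suc j)
  have ev: "\<forall>\<^sub>F s in at_top. 0 < (s::real)" using eventually_gt_at_top .
  have 1: "filterlim (slope (Suc j)) at_top at_top" if j: "Suc j \<le> m"
  proof (rule filterlim_at_top_mono)
    let ?K = "k j * (U (Suc j) - U j) / (2 * (a j)\<^sup>2 * k (Suc j))"
    have K: "0 < ?K" using k_pos[of j] k_pos[of "Suc j"] U_less[of j] a_pos[of j] j by simp
    have x: "filterlim (front j) at_top at_top" using Suc j by simp
    have "filterlim (\<lambda>r. inverse (h (Suc j) r)) at_top at_top"
      by (intro filterlim_inverse_at_top h_at_top j eventually_mono[OF eventually_gt_at_top[of 0]] h_pos)
    then have "filterlim (\<lambda>r. r * inverse (h (Suc j) r)) at_top at_top"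
      by (intro filterlim_at_top_mult_at_top filterlim_ident)
    then have "filterlim (\<lambda>r. ?K * (r / h (Suc j) r)) at_top at_top"
      by (intro filterlim_tendsto_pos_mult_at_top[OF tendsto_const K]) (simp add: divide_inverse)
    from filterlim_compose[OF this x]
    show "filterlim (\<lambda>s. ?K * (front j s / h (Suc j) (front j s))) at_top at_top" .
    show "\<forall>\<^sub>F s in at_top. ?K * (front j s / h (Suc j) (front j s)) \<le> slope (Suc j) s"
      using ev by eventually_elim (use slope_Suc_ge j in blast)
  qed
  moreover have "filterlim (front (Suc j)) at_top at_top" if j: "Suc j < m"
  proof (rule front_at_top)
    show "\<forall>\<^sub>F s in at_top. 0 < front (Suc j) s"
      using ev by eventually_elim (use front_pos j in blast)
    have "((\<lambda>s. H (Suc j) (front j s) + (U (Suc (Suc j)) - U (Suc j)) / slope (Suc j) s) \<longlongrightarrow> 0 + 0) at_top"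
      (is "(?f \<longlongrightarrow> _) _") using j Suc 1
      by (intro tendsto_add filterlim_compose[OF H_at_top] real_tendsto_divide_at_top[OF tendsto_const]) auto
    then have lim: "(?f \<longlongrightarrow> 0) at_top" by simp
    show "((\<lambda>s. H (Suc j) (front (Suc j) s)) \<longlongrightarrow> 0) at_top"
    proof (rule Lim_transform_eventually[OF lim])
      show "\<forall>\<^sub>F s in at_top. H (Suc j) (front j s) + (U (Suc (Suc j)) - U (Suc j)) / slope (Suc j) s
          = H (Suc j) (front (Suc j) s)"
        using ev by eventually_elim (use H_front_Suc[of j] front_pos[of _ j] slope_pos[of _ "Suc j"] j in auto)
    qed
  qed (use j in auto)
  ultimately show ?case by blast
qed

end

text \<open>All that the verification needs to know about the outcome of the shooting.
  \<open>x i\<close> is \<xi> i for i \<ge> 1. The infinite \<xi> 0 has no real value, so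
  \<open>x 0\<close> is never read and \<open>drop\<close> treats phase 0 separately.\<close>

locale stefan_fronts = stefan_data +
  fixes A :: real and x c :: "nat \<Rightarrow> real"
  assumes m_pos: "0 < m"
    and x_pos: "\<And>i. 1 \<le> i \<Longrightarrow> i \<le> m \<Longrightarrow> 0 < x i"
    and x_less: "\<And>i. 1 \<le> i \<Longrightarrow> i < m \<Longrightarrow> x (Suc i) < x i"
    and c_pos: "\<And>i. i \<le> m \<Longrightarrow> 0 < c i"
    and c_m: "c m = A"
    and drop: "\<And>i. i < m \<Longrightarrow> U (Suc i) - U i = c i * (H i (x (Suc i)) - (if i = 0 then 0 else H i (x i)))"
    and jump: "\<And>i. i < m \<Longrightarrow> d (Suc i) * x (Suc i) / 2 + k i * c i * h i (x (Suc i)) =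
        k (Suc i) * c (Suc i) * h (Suc i) (x (Suc i))"

lemma (in stefan_data) exists_fronts:
  assumes "0 < m" "0 < A"
  shows "\<exists>x c. stefan_fronts n m U a k d A x c"
proof -
  have cont: "continuous_on {0<..} (slope m)"
    using continuous_shoot[of m] assms by auto
  have "\<forall>\<^sub>F s in at_right 0. 0 < s \<and> slope m s < A"
    using order_tendstoD(2)[of "slope m" 0 "at_right 0" A] shoot_at_0[of m] assms eventually_at_right_less[of "0::real"]
    by (auto simp: eventually_conj_iff)
  then obtain l where l: "0 < l" "slope m l < A"
    using eventually_happens'[OF trivial_limit_at_right_real] by blast
  have "\<forall>\<^sub>F s in at_top. l < s \<and> A < slope m s"
    using shoot_at_top[of m] assms eventually_gt_at_top[of l]
    by (auto simp: eventually_conj_iff filterlim_at_top_dense)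
  then obtain u where u: "l < u" "A < slope m u"
    using eventually_happens'[OF trivial_limit_at_top_linorder] by blast
  have "\<exists>s. l \<le> s \<and> s \<le> u \<and> slope m s = A"
    by (rule IVT') (use l u in \<open>auto intro!: continuous_on_subset[OF cont]\<close>)
  then obtain s where s: "0 < s" "slope m s = A" using order.strict_trans2[OF l(1)] by blast
  \<comment> \<open>The shooting numbers the inner front of phase j by j, whereas this front is
    \<xi> (j + 1); hence the shift. At i = 0 truncated subtraction gives a harmless value.\<close>
  have "stefan_fronts n m U a k d A (\<lambda>i. front (i - 1) s) (\<lambda>i. slope i s)"
  proof
    show "front (Suc i - 1) s < front (i - 1) s" if "1 \<le> i" "i < m" for i
      using that front_Suc_less[of "i - 1" s] front_pos[of s "i - 1"] slope_pos[of s i] s by auto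
    show "d (Suc i) * front (Suc i - 1) s / 2 + k i * slope i s * h i (front (Suc i - 1) s) =
        k (Suc i) * slope (Suc i) s * h (Suc i) (front (Suc i - 1) s)" if "i < m" for i
      using that h_pos[of "Suc i" "front i s"] k_pos[of "Suc i"] front_pos[of s i] s
      by (simp add: slope_Suc)
  qed (use s assms in \<open>auto simp: front_pos slope_pos slope_drop\<close>)
  then show ?thesis by blast
qed

section \<open>Radial functions of the similarity variable\<close>

definition radial_set :: "real set \<Rightarrow> (real \<times> (real^'n)) set" where
  "radial_set J = {(t, x) \<in> stefan_domain. norm x / sqrt t \<in> J}"

lemma stefan_domain_eq: "stefan_domain = {0<..} \<times> (- {0})"
  by (auto simp: stefan_domain_def)

lemma open_stefan_domain: "open stefan_domain"
  unfolding stefan_domain_eq by (intro open_Times) (simp_all add: open_Compl)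

lemma continuous_on_similarity:
  "continuous_on stefan_domain (\<lambda>q :: real \<times> (real^'n). norm (snd q) / sqrt (fst q))"
  by (intro continuous_intros) (auto simp: stefan_domain_def)

lemma open_radial_set:
  assumes "open J"
  shows "open (radial_set J :: (real \<times> (real^'n)) set)"
proof -
  have "radial_set J = stefan_domain \<inter> (\<lambda>q :: real \<times> (real^'n). norm (snd q) / sqrt (fst q)) -` J"
    by (auto simp: radial_set_def)
  then show ?thesis
    using continuous_open_preimage[OF continuous_on_similarity open_stefan_domain assms] by simp
qed

lemma grad_x_eq: "GDERIV (u t) x :> D \<Longrightarrow> grad_x u (t, x) = D"
  unfolding grad_x_def fst_conv snd_conv
proof (rule the_equality)
  fix D' assume "GDERIV (u t) x :> D" "GDERIV (u t) x :> D'"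
  then have "(\<lambda>h. inner h D) = (\<lambda>h. inner h D')"
    unfolding gderiv_def by (rule has_derivative_unique)
  then show "D' = D" by (metis inner_commute vector_eq_ldot)
qed

lemma GDERIV_radial:
  fixes x :: "real^'n"
  assumes "0 < t" "x \<noteq> 0" "(v has_real_derivative v') (at (norm x / sqrt t))"
  shows "GDERIV (\<lambda>x. v (norm x / sqrt t)) x :> (v' / (sqrt t * norm x)) *\<^sub>R x"
proof -
  have "((\<lambda>s. s / sqrt t) has_real_derivative 1 / sqrt t) (at (norm x))"
    by (rule DERIV_cdivide[OF DERIV_ident])
  from GDERIV_DERIV_compose[OF GDERIV_DERIV_compose[OF GDERIV_norm[OF assms(2)] this] assms(3)] assms(1)
  show ?thesis by (simp add: sgn_div_norm divide_inverse mult_ac real_sqrt_inverse)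
qed

text \<open>For u = v (|x| / sqrt t) both sides of the heat equation carry a factor 1 / t. What
  remains is the ordinary differential equation \<open>ode\<close>, with w = v' and w' =
  v''.\<close>

lemma heat_solution_on_radial_set:
  fixes v w w' :: "real \<Rightarrow> real"
  assumes J: "open J" "J \<subseteq> {0<..}"
    and v: "\<And>r. r \<in> J \<Longrightarrow> (v has_real_derivative w r) (at r)"
    and w: "\<And>r. r \<in> J \<Longrightarrow> (w has_real_derivative w' r) (at r)"
    and w': "continuous_on J w'"
    and ode: "\<And>r. r \<in> J \<Longrightarrow> c * (w' r + (real CARD('n) - 1) / r * w r) = - r / 2 * w r"
  shows "heat_solution_on (radial_set J) c (\<lambda>t (x :: real^'n). v (norm x / sqrt t))"
proof -
  define \<rho> where "\<rho> = (\<lambda>q :: real \<times> (real^'n). norm (snd q) / sqrt (fst q))"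
  define u where "u = (\<lambda>t (x :: real^'n). v (norm x / sqrt t))"
  define W where "W = (radial_set J :: (real \<times> (real^'n)) set)"
  define ut where "ut = (\<lambda>q. - w (\<rho> q) * \<rho> q / (2 * fst q))"
  \<comment> \<open>Since sqrt t * |x| = \<rho> * t, the spatial gradient is p (\<rho>) / t times x
    with p r = w r / r. The product rule then gives the Hessian \<open>H\<close>, in which
    \<open>p'\<close> is the derivative of p.\<close>
  define g where "g = (\<lambda>q. (w (\<rho> q) / \<rho> q / fst q) *\<^sub>R snd q)"
  define p' where "p' = (\<lambda>r. w' r / r - w r / r\<^sup>2)"
  define H where "H = (\<lambda>q h. (p' (\<rho> q) * inner h (snd q) / (norm (snd q) * sqrt (fst q)) / fst q) *\<^sub>R snd q
      + (w (\<rho> q) / \<rho> q / fst q) *\<^sub>R h)"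
  have W: "0 < fst q" "snd q \<noteq> 0" "\<rho> q \<in> J" "0 < \<rho> q" if "q \<in> W" for q
    using that J(2) by (auto simp: W_def radial_set_def stefan_domain_def \<rho>_def)
  have openW: "open W" unfolding W_def by (rule open_radial_set[OF J(1)])
  have \<rho>_cont: "continuous_on W \<rho>"
    unfolding \<rho>_def by (rule continuous_on_subset[OF continuous_on_similarity])
      (auto simp: W_def radial_set_def)
  have comp: "continuous_on W (\<lambda>q. f (\<rho> q))" if "continuous_on J f" for f :: "real \<Rightarrow> real"
    by (rule continuous_on_compose2[OF that \<rho>_cont]) (use W in auto)
  have w_cont: "continuous_on J w"
    using w DERIV_isCont by (intro continuous_at_imp_continuous_on) blast
  have p'_cont: "continuous_on J p'"
    unfolding p'_def by (intro continuous_intros w' w_cont) (use J in force)+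
  have \<rho>t: "sqrt (fst q) * norm (snd q) = \<rho> q * fst q" if "q \<in> W" for q
    using real_sqrt_mult_self[of "fst q"] W[OF that] unfolding \<rho>_def
    by (simp add: divide_simps del: real_sqrt_mult_self)
  have p_deriv: "((\<lambda>r. w r / r) has_real_derivative p' r) (at r)" if "r \<in> J" for r
    using w[OF that] J(2) that
    by (auto intro!: derivative_eq_intros simp: p'_def power2_eq_square diff_divide_distrib)
  have grad_u: "GDERIV (u (fst q)) (snd q) :> g q" if "q \<in> W" for q
    using GDERIV_radial[of "fst q" "snd q" v "w (\<rho> q)"] W[OF that] v[of "\<rho> q"] \<rho>t[OF that]
    by (simp add: g_def u_def \<rho>_def)
  then have grad: "grad_x u q = g q" if "q \<in> W" for q
    using that grad_x_eq[of u "fst q" "snd q" "g q"] by simp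
  show ?thesis
    unfolding u_def[symmetric] W_def[symmetric] heat_solution_on_def
  proof (intro exI[of _ ut] exI[of _ H] conjI allI impI)
    show "continuous_on W ut"
      unfolding ut_def by (intro continuous_intros comp w_cont \<rho>_cont) (use W in force)
    have "continuous_on W g"
      unfolding g_def by (intro continuous_intros comp w_cont \<rho>_cont) (use W in force)+
    then show "continuous_on W (grad_x u)"
      by (rule continuous_on_cong[THEN iffD1, rotated -1]) (use grad in auto)
    show "continuous_on W (\<lambda>q. H q h)" for h
      unfolding H_def by (intro continuous_intros comp w_cont p'_cont \<rho>_cont) (use W in force)+
    fix t x assume tx: "(t, x) \<in> W"
    have t: "0 < t" and x: "x \<noteq> 0" and r: "norm x / sqrt t \<in> J" "0 < norm x / sqrt t"
      using W[OF tx] by (auto simp: \<rho>_def)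
    have "((\<lambda>s. norm x / sqrt s) has_real_derivative - (norm x / sqrt t) / (2 * t)) (at t)"
      using t by (auto intro!: derivative_eq_intros simp: field_simps)
    from DERIV_chain'[OF this v[OF r(1)]]
    show "((\<lambda>s. u s x) has_real_derivative ut (t, x)) (at t)"
      by (simp add: u_def ut_def \<rho>_def mult_ac)
    show "GDERIV (u t) x :> grad_x u (t, x)"
      using grad_u[OF tx] grad[OF tx] by simp
    show "((\<lambda>y. grad_x u (t, y)) has_derivative H (t, x)) (at x)"
    proof (rule has_derivative_transform_within_open)
      show "open {y. (t, y) \<in> W}"
        using open_vimage[OF openW, of "Pair t"] by (simp add: vimage_def continuous_intros)
      show "g (t, y) = grad_x u (t, y)" if "y \<in> {y. (t, y) \<in> W}" for y
        using that grad by simp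
      from GDERIV_radial[OF t x p_deriv[OF r(1)]]
      have "((\<lambda>y. w (norm y / sqrt t) / (norm y / sqrt t)) has_derivative
          (\<lambda>h. inner h ((p' (norm x / sqrt t) / (sqrt t * norm x)) *\<^sub>R x))) (at x)"
        by (simp add: gderiv_def)
      moreover have "((\<lambda>y. (f y / t) *\<^sub>R y) has_derivative (\<lambda>h. (f x / t) *\<^sub>R h + (f' h / t) *\<^sub>R x)) (at x)"
        if "(f has_derivative f') (at x)" for f f' and x :: "real^'n"
        using that t by (auto intro!: derivative_eq_intros)
      ultimately have "((\<lambda>y. (w (norm y / sqrt t) / (norm y / sqrt t) / t) *\<^sub>R y) has_derivative
          (\<lambda>h. (w (norm x / sqrt t) / (norm x / sqrt t) / t) *\<^sub>R h +
            (inner h ((p' (norm x / sqrt t) / (sqrt t * norm x)) *\<^sub>R x) / t) *\<^sub>R x)) (at x)"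
        by blast
      then show "((\<lambda>y. g (t, y)) has_derivative H (t, x)) (at x)"
        by (simp add: g_def H_def \<rho>_def mult_ac add_ac)
    qed (use tx in simp)
    let ?r = "norm x / sqrt t"
    \<comment> \<open>The rank-one part of the Hessian has trace p' * r / t and the multiple of the
      identity has trace N * p / t, with N the dimension. As p' * r = w' - w / r, one of the N
      copies of w / r cancels, which leaves the radial Laplacian.\<close>
    have "(\<Sum>j\<in>UNIV. H (t, x) (axis j 1) $ j) =
        (\<Sum>j\<in>UNIV. p' ?r / (norm x * sqrt t) / t * (x $ j * x $ j) + w ?r / ?r / t)"
      by (simp add: H_def \<rho>_def inner_axis' mult_ac)
    also have "\<dots> = p' ?r / (norm x * sqrt t) / t * (norm x)\<^sup>2 + real CARD('n) * (w ?r / ?r / t)"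
      by (simp add: sum.distrib sum_distrib_left sum_divide_distrib power2_norm_eq_inner inner_vec_def)
    also have "\<dots> = p' ?r * ?r / t + real CARD('n) * (w ?r / ?r) / t"
    proof -
      have nx: "norm x \<noteq> 0" using x by simp
      have "P / (X * S) / T * X\<^sup>2 = P * (X / S) / T" if "X \<noteq> 0" for P X S T :: real
        using that by (simp add: power2_eq_square)
      from this[OF nx] have "p' ?r / (norm x * sqrt t) / t * (norm x)\<^sup>2 = p' ?r * ?r / t" .
      then show ?thesis by (simp only: times_divide_eq_right)
    qed
    also have "\<dots> = (w' ?r + (real CARD('n) - 1) / ?r * w ?r) / t"
    proof -
      have "p' \<rho> * \<rho> / T + N * (w \<rho> / \<rho>) / T = (w' \<rho> + (N - 1) / \<rho> * w \<rho>) / T" if "0 < \<rho>" for \<rho> N T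
      proof -
        have "p' \<rho> * \<rho> = w' \<rho> - w \<rho> / \<rho>"
          using that by (simp add: p'_def power2_eq_square left_diff_distrib)
        moreover have "(N - 1) / \<rho> * w \<rho> = N * (w \<rho> / \<rho>) - w \<rho> / \<rho>"
          by (simp add: left_diff_distrib diff_divide_distrib)
        ultimately show ?thesis by (simp add: add_divide_distrib diff_divide_distrib)
      qed
      from this[OF r(2)] show ?thesis .
    qed
    finally have "c * (\<Sum>j\<in>UNIV. H (t, x) (axis j 1) $ j) = c * (w' ?r + (real CARD('n) - 1) / ?r * w ?r) / t"
      by simp
    also have "\<dots> = ut (t, x)"
      unfolding ode[OF r(1)] by (simp add: ut_def \<rho>_def mult_ac)
    finally show "ut (t, x) = c * (\<Sum>j\<in>UNIV. H (t, x) (axis j 1) $ j)" by simp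
  qed (rule openW)
qed

section \<open>Geometry of the fronts: paraboloids and their normals\<close>

lemma radial_surface_eq:
  assumes "0 < \<xi>" "0 < t"
  shows "norm x / sqrt t = \<xi> \<longleftrightarrow> inner x x - \<xi>\<^sup>2 * t = 0"
proof -
  have "norm x / sqrt t = \<xi> \<longleftrightarrow> norm x = \<xi> * sqrt t"
    using assms by (simp add: field_simps)
  also have "\<dots> \<longleftrightarrow> (norm x)\<^sup>2 = (\<xi> * sqrt t)\<^sup>2"
    using assms by (intro power2_eq_iff_nonneg[symmetric]) auto
  finally show ?thesis
    using assms by (simp add: power_mult_distrib power2_norm_eq_inner)
qed

lemma GDERIV_radial_surface:
  fixes q :: "real \<times> (real^'n)"
  shows "GDERIV (\<lambda>q. inner (snd q) (snd q) - \<xi>\<^sup>2 * fst q) q :> (- \<xi>\<^sup>2, 2 *\<^sub>R snd q)"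
  unfolding gderiv_def
  by (rule derivative_eq_intros refl)+
     (auto simp: inner_prod_def inner_commute algebra_simps)

text \<open>The polynomial |x|^2 - \<xi>^2 t describes the front in the whole domain, and its
  gradient has the nonzero time component - \<xi>^2, so one defining function serves all
  points.\<close>

lemma C1_hypersurface_radial_set:
  assumes "0 < \<xi>"
  shows "C1_hypersurface (radial_set {\<xi>} :: (real \<times> (real^'n)) set)"
  unfolding C1_hypersurface_def
proof
  let ?\<phi> = "\<lambda>q :: real \<times> (real^'n). inner (snd q) (snd q) - \<xi>\<^sup>2 * fst q"
  let ?g = "\<lambda>q :: real \<times> (real^'n). (- \<xi>\<^sup>2, 2 *\<^sub>R snd q)"
  fix p :: "real \<times> (real^'n)" assume p: "p \<in> radial_set {\<xi>}"
  show "\<exists>W (\<phi> :: real \<times> (real^'n) \<Rightarrow> real) g. open W \<and> p \<in> W \<and> continuous_on W g \<and>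
      (\<forall>q\<in>W. (GDERIV \<phi> q :> g q) \<and> g q \<noteq> 0) \<and> radial_set {\<xi>} \<inter> W = {q \<in> W. \<phi> q = 0}"
  proof (rule exI[of _ stefan_domain], rule exI[of _ ?\<phi>], rule exI[of _ ?g], intro conjI ballI)
    show "p \<in> stefan_domain" using p by (auto simp: radial_set_def)
    show "continuous_on stefan_domain ?g" by (intro continuous_intros)
    show "?g q \<noteq> 0" for q using assms by (simp add: zero_prod_def)
    show "radial_set {\<xi>} \<inter> stefan_domain = {q \<in> stefan_domain. ?\<phi> q = 0}"
    proof (rule set_eqI)
      fix q :: "real \<times> (real^'n)"
      show "q \<in> radial_set {\<xi>} \<inter> stefan_domain \<longleftrightarrow> q \<in> {q \<in> stefan_domain. ?\<phi> q = 0}"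
        using radial_surface_eq[OF assms, of "fst q" "snd q"]
        unfolding radial_set_def stefan_domain_def case_prod_beta mem_Collect_eq Int_iff
          singleton_iff fst_conv snd_conv
        by blast
    qed
  qed (rule open_stefan_domain GDERIV_radial_surface)+
qed

text \<open>The defining polynomial vanishes along every curve in the front, so its gradient is
  orthogonal to the velocity. The vector here is the negative gradient, the sign being chosen so as
  to point to the warmer side.\<close>

lemma normal_vector_radial_set:
  fixes x :: "real^'n"
  assumes "0 < \<xi>" "(t, x) \<in> radial_set {\<xi>}"
  shows "normal_vector (radial_set {\<xi>}) (t, x) (\<xi>\<^sup>2, - 2 *\<^sub>R x)"
  unfolding normal_vector_def
proof (intro conjI allI impI)
  fix \<gamma> :: "real \<Rightarrow> real \<times> (real^'n)" and w
  assume \<gamma>: "\<gamma> 0 = (t, x)" "\<forall>\<^sub>F s in nhds 0. \<gamma> s \<in> radial_set {\<xi>}" "(\<gamma> has_vector_derivative w) (at 0)"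
  let ?\<phi> = "\<lambda>q :: real \<times> (real^'n). inner (snd q) (snd q) - \<xi>\<^sup>2 * fst q"
  have "(?\<phi> has_derivative (\<lambda>h. inner h (- \<xi>\<^sup>2, 2 *\<^sub>R x))) (at (\<gamma> 0))"
    using GDERIV_radial_surface[of \<xi> "(t, x)"] \<gamma>(1) by (simp add: gderiv_def)
  from vector_derivative_diff_chain_within[OF \<gamma>(3) has_derivative_at_withinI[OF this]]
  have 1: "((\<lambda>s. ?\<phi> (\<gamma> s)) has_real_derivative inner w (- \<xi>\<^sup>2, 2 *\<^sub>R x)) (at 0)"
    by (simp add: has_real_derivative_iff_has_vector_derivative o_def)
  have 2: "\<forall>\<^sub>F s in nhds 0. ?\<phi> (\<gamma> s) = 0"
    using \<gamma>(2)
  proof eventually_elim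
    case (elim s)
    then show ?case
      using radial_surface_eq[OF assms(1), of "fst (\<gamma> s)" "snd (\<gamma> s)"]
      by (auto simp: radial_set_def stefan_domain_def split: prod.splits)
  qed
  have "((\<lambda>s. ?\<phi> (\<gamma> s)) has_real_derivative 0) (at 0)"
    by (subst DERIV_cong_ev[OF refl 2 refl]) simp
  with 1 have "inner w (- \<xi>\<^sup>2, 2 *\<^sub>R x) = 0" by (rule DERIV_unique)
  then show "inner w (\<xi>\<^sup>2, - 2 *\<^sub>R x) = 0"
    by (simp add: inner_prod_def)
qed (use assms in \<open>auto simp: zero_prod_def\<close>)

text \<open>One curve is enough: time runs while x is dilated so that |x| / sqrt t stays fixed, and
  its velocity at the point is (1, x / (2 t)). Since the gradients of a radial function are parallel
  to x, no other tangent direction matters for the Stefan condition.\<close>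

lemma normal_vector_radial_set_orthogonal:
  fixes x :: "real^'n"
  assumes "(t, x) \<in> radial_set {\<xi>}" "normal_vector (radial_set {\<xi>}) (t, x) (\<nu>t, \<nu>x)"
  shows "\<nu>t + inner x \<nu>x / (2 * t) = 0"
proof -
  have t: "0 < t" and x: "x \<noteq> 0" and \<xi>: "norm x / sqrt t = \<xi>"
    using assms by (auto simp: radial_set_def stefan_domain_def)
  define \<gamma> where "\<gamma> = (\<lambda>s. (t + s, sqrt ((t + s) / t) *\<^sub>R x))"
  have "\<gamma> 0 = (t, x)" using t by (simp add: \<gamma>_def)
  moreover have "\<forall>\<^sub>F s in nhds 0. s \<in> {- t<..}"
    using t by (intro eventually_nhds_in_open) auto
  then have "\<forall>\<^sub>F s in nhds 0. \<gamma> s \<in> radial_set {\<xi>}"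
  proof eventually_elim
    case (elim s)
    then have "0 < t + s" by simp
    then show ?case
      using t x \<xi> by (simp add: \<gamma>_def radial_set_def stefan_domain_def real_sqrt_divide)
  qed
  moreover have "(\<gamma> has_vector_derivative (1, (1 / (2 * t)) *\<^sub>R x)) (at 0)"
  proof -
    have "((\<lambda>s. sqrt ((t + s) / t)) has_real_derivative 1 / (2 * t)) (at 0)"
      using t by (auto intro!: derivative_eq_intros simp: field_simps)
    then have "((\<lambda>s. sqrt ((t + s) / t) *\<^sub>R x) has_vector_derivative (1 / (2 * t)) *\<^sub>R x) (at 0)"
      using has_vector_derivative_scaleR[of _ _ "0::real" UNIV "\<lambda>_. x" 0] by (auto simp: has_vector_derivative_const)
    moreover have "((\<lambda>s. t + s) has_vector_derivative 1) (at 0)"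
      by (auto intro!: derivative_eq_intros)
    ultimately show ?thesis
      unfolding \<gamma>_def by (rule has_vector_derivative_Pair[rotated])
  qed
  ultimately have "inner (1, (1 / (2 * t)) *\<^sub>R x) (\<nu>t, \<nu>x) = 0"
    using assms(2) unfolding normal_vector_def by blast
  then show ?thesis by (simp add: inner_prod_def)
qed

text \<open>Moving along the vector increases t and shrinks x, so the similarity variable drops
  below \<xi>; moving against it does the opposite. Only the parts of \<open>Jp\<close> and
  \<open>Jm\<close> next to \<xi> are concerned, hence \<open>lo\<close> and
  \<open>hi\<close>.\<close>

lemma directed_normal_radial_set:
  fixes x :: "real^'n"
  assumes "0 < \<xi>" "(t, x) \<in> radial_set {\<xi>}"
    and lo: "lo < \<xi>" "{lo<..<\<xi>} \<subseteq> Jp" and hi: "\<xi> < hi" "{\<xi><..<hi} \<subseteq> Jm"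
  shows "directed_normal (radial_set {\<xi>}) (radial_set Jm) (radial_set Jp) (t, x) (\<xi>\<^sup>2, - 2 *\<^sub>R x)"
  unfolding directed_normal_def
proof
  have t: "0 < t" and x: "x \<noteq> 0" and \<xi>: "norm x / sqrt t = \<xi>"
    using assms by (auto simp: radial_set_def stefan_domain_def)
  \<comment> \<open>The bound 1 / 2 keeps the factor 1 - 2 s of x positive; the other bound keeps
    the time t - s \<xi>^2 positive.\<close>
  have ev: "\<forall>\<^sub>F s in at_right 0. 0 < s \<and> s < 1 / 2 \<and> s * \<xi>\<^sup>2 < t"
  proof (rule eventually_at_rightI)
    show "0 < min (1 / 2) (t / \<xi>\<^sup>2)" using t assms(1) by simp
  qed (use assms(1) in \<open>auto simp: field_simps\<close>)
  \<comment> \<open>Continuity at s = 0 yields only the far bounds \<open>lo\<close> and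
    \<open>hi\<close>. The limit is \<xi> itself, so the strict comparison with \<xi> needs the
    direct estimate further down.\<close>
  have "((\<lambda>s. (1 - 2 * s) * norm x / sqrt (t + s * \<xi>\<^sup>2)) \<longlongrightarrow> \<xi>) (at_right 0)"
    by (rule tendsto_eq_intros refl | use t \<xi> in simp)+
  from order_tendstoD(1)[OF this lo(1)] have
    evp: "\<forall>\<^sub>F s in at_right 0. lo < (1 - 2 * s) * norm x / sqrt (t + s * \<xi>\<^sup>2)" .
  have "((\<lambda>s. (1 + 2 * s) * norm x / sqrt (t - s * \<xi>\<^sup>2)) \<longlongrightarrow> \<xi>) (at_right 0)"
    by (rule tendsto_eq_intros refl | use t \<xi> in simp)+
  from order_tendstoD(2)[OF this hi(1)] have
    evm: "\<forall>\<^sub>F s in at_right 0. (1 + 2 * s) * norm x / sqrt (t - s * \<xi>\<^sup>2) < hi" .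
  show "\<forall>\<^sub>F s in at_right 0. (t, x) + s *\<^sub>R (\<xi>\<^sup>2, - 2 *\<^sub>R x) \<in> radial_set Jp \<and>
      (t, x) - s *\<^sub>R (\<xi>\<^sup>2, - 2 *\<^sub>R x) \<in> radial_set Jm"
    using ev evp evm
  proof eventually_elim
    case (elim s)
    have xs: "x - (2 * s) *\<^sub>R x = (1 - 2 * s) *\<^sub>R x" "x + (2 * s) *\<^sub>R x = (1 + 2 * s) *\<^sub>R x"
      by (simp_all add: algebra_simps)
    have n: "norm ((1 - 2 * s) *\<^sub>R x) = (1 - 2 * s) * norm x" "norm ((1 + 2 * s) *\<^sub>R x) = (1 + 2 * s) * norm x"
      using elim by simp_all
    have nx: "norm x = \<xi> * sqrt t" using t \<xi> by (simp add: field_simps)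
    have "(1 - 2 * s) * norm x < 1 * norm x" "1 * norm x < (1 + 2 * s) * norm x"
      using elim x by (intro mult_strict_right_mono; simp)+
    moreover have "\<xi> * sqrt t \<le> \<xi> * sqrt (t + s * \<xi>\<^sup>2)" "\<xi> * sqrt (t - s * \<xi>\<^sup>2) \<le> \<xi> * sqrt t"
      using assms(1) elim by auto
    ultimately have "(1 - 2 * s) * norm x < \<xi> * sqrt (t + s * \<xi>\<^sup>2)"
      "\<xi> * sqrt (t - s * \<xi>\<^sup>2) < (1 + 2 * s) * norm x"
      unfolding nx by linarith+
    moreover have "0 < t + s * \<xi>\<^sup>2" "0 < t - s * \<xi>\<^sup>2"
      using elim t by (auto intro!: add_pos_nonneg)
    ultimately have "(1 - 2 * s) * norm x / sqrt (t + s * \<xi>\<^sup>2) \<in> Jp"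
      "(1 + 2 * s) * norm x / sqrt (t - s * \<xi>\<^sup>2) \<in> Jm"
      using elim by (auto intro!: subsetD[OF lo(2)] subsetD[OF hi(2)] simp: field_simps)
    then show ?case
      using elim x \<open>0 < t + s * \<xi>\<^sup>2\<close> \<open>0 < t - s * \<xi>\<^sup>2\<close>
      by (simp add: radial_set_def stefan_domain_def mult.commute[of s 2] xs n del: norm_scaleR)
  qed
qed (rule normal_vector_radial_set[OF assms(1,2)])

text \<open>\<open>w\<close> is the derivative of \<open>v\<close> only inside the phase, but as a
  formula it is continuous at the front too, so its value there supplies the one-sided
  limit.\<close>

lemma grad_x_radial_tendsto:
  fixes x :: "real^'n"
  assumes "0 < t" "x \<noteq> 0" "\<And>r. r \<in> J \<Longrightarrow> (v has_real_derivative w r) (at r)"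
    and "isCont w (norm x / sqrt t)"
  shows "(grad_x (\<lambda>t (x :: real^'n). v (norm x / sqrt t)) \<longlongrightarrow>
      (w (norm x / sqrt t) / (sqrt t * norm x)) *\<^sub>R x) (at (t, x) within radial_set J)"
proof (rule Lim_transform_eventually)
  show "((\<lambda>q. (w (norm (snd q) / sqrt (fst q)) / (sqrt (fst q) * norm (snd q))) *\<^sub>R snd q) \<longlongrightarrow>
      (w (norm x / sqrt t) / (sqrt t * norm x)) *\<^sub>R x) (at (t, x) within radial_set J)"
    by (intro tendsto_intros isCont_tendsto_compose[OF assms(4)] tendsto_eq_intros refl)
       (use assms in auto)
  show "\<forall>\<^sub>F q in at (t, x) within radial_set J.
      (w (norm (snd q) / sqrt (fst q)) / (sqrt (fst q) * norm (snd q))) *\<^sub>R snd q =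
      grad_x (\<lambda>t (x :: real^'n). v (norm x / sqrt t)) q"
    unfolding eventually_at_filter
  proof (rule always_eventually, intro allI impI)
    fix q :: "real \<times> (real^'n)" assume "q \<in> radial_set J"
    then have "0 < fst q" "snd q \<noteq> 0" "norm (snd q) / sqrt (fst q) \<in> J"
      by (auto simp: radial_set_def stefan_domain_def)
    from GDERIV_radial[OF this(1,2) assms(3)[OF this(3)]]
    show "(w (norm (snd q) / sqrt (fst q)) / (sqrt (fst q) * norm (snd q))) *\<^sub>R snd q =
      grad_x (\<lambda>t (x :: real^'n). v (norm x / sqrt t)) q"
      using grad_x_eq[of "\<lambda>t (x :: real^'n). v (norm x / sqrt t)" "fst q" "snd q"] by simp
  qed
qed

lemma stefan_condition_radial:
  fixes u :: "real \<Rightarrow> real^'n \<Rightarrow> real"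
  assumes u: "u = (\<lambda>t x. v (norm x / sqrt t))"
    and S: "transition_surface U u i = radial_set {\<xi>}"
    and Wm: "phase_region m U u (i - 1) = radial_set Jm"
    and Wp: "phase_region m U u i = radial_set Jp"
    and lo: "lo < \<xi>" "{lo<..<\<xi>} \<subseteq> Jp" and hi: "\<xi> < hi" "{\<xi><..<hi} \<subseteq> Jm"
    and wm: "\<And>r. r \<in> Jm \<Longrightarrow> (v has_real_derivative wm r) (at r)" "isCont wm \<xi>"
    and wp: "\<And>r. r \<in> Jp \<Longrightarrow> (v has_real_derivative wp r) (at r)" "isCont wp \<xi>"
    and \<xi>: "0 < \<xi>"
    and jump: "d i * \<xi> / 2 + k i * wp \<xi> - k (i - 1) * wm \<xi> = 0"
  shows "stefan_condition m U k d u i"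
  unfolding stefan_condition_def Let_def S Wm Wp
proof (intro conjI ballI)
  show "C1_hypersurface (radial_set {\<xi>} :: (real \<times> (real^'n)) set)"
    by (rule C1_hypersurface_radial_set[OF \<xi>])
  fix p :: "real \<times> (real^'n)" assume p: "p \<in> radial_set {\<xi>}"
  obtain t x where tx: "p = (t, x)" by (cases p)
  have t: "0 < t" and x: "x \<noteq> 0" and r: "norm x / sqrt t = \<xi>"
    using p tx by (auto simp: radial_set_def stefan_domain_def)
  show "\<exists>\<nu>. directed_normal (radial_set {\<xi>}) (radial_set Jm) (radial_set Jp) p \<nu>"
    using directed_normal_radial_set[OF \<xi> _ lo hi] p tx by blast
  let ?gm = "(wm \<xi> / (sqrt t * norm x)) *\<^sub>R x" and ?gp = "(wp \<xi> / (sqrt t * norm x)) *\<^sub>R x"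
  show "\<exists>gm gp. (grad_x u \<longlongrightarrow> gm) (at p within radial_set Jm) \<and>
      (grad_x u \<longlongrightarrow> gp) (at p within radial_set Jp) \<and>
      (\<forall>\<nu>t \<nu>x. directed_normal (radial_set {\<xi>}) (radial_set Jm) (radial_set Jp) p (\<nu>t, \<nu>x) \<longrightarrow>
         - d i * \<nu>t + inner (k i *\<^sub>R gp - k (i - 1) *\<^sub>R gm) \<nu>x = 0)"
  proof (rule exI[of _ ?gm], rule exI[of _ ?gp], intro conjI allI impI)
    show "(grad_x u \<longlongrightarrow> ?gm) (at p within radial_set Jm)"
      using grad_x_radial_tendsto[OF t x wm(1)] wm(2) unfolding u tx r by blast
    show "(grad_x u \<longlongrightarrow> ?gp) (at p within radial_set Jp)"
      using grad_x_radial_tendsto[OF t x wp(1)] wp(2) unfolding u tx r by blast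
    fix \<nu>t :: real and \<nu>x :: "real^'n" assume "directed_normal (radial_set {\<xi>}) (radial_set Jm) (radial_set Jp) p (\<nu>t, \<nu>x)"
    then have *: "\<nu>t + inner x \<nu>x / (2 * t) = 0"
      using normal_vector_radial_set_orthogonal p tx unfolding directed_normal_def by blast
    have "sqrt t * norm x = \<xi> * t"
      using t r by (auto simp: field_simps)
    \<comment> \<open>By \<open>jump\<close> the difference of the fluxes is - d i / (2 t) times x.
      The Stefan expression thus becomes - d i times the inner product of the normal with the
      tangent (1, x / (2 t)), which vanishes.\<close>
    moreover have "k i * wp \<xi> - k (i - 1) * wm \<xi> = - (d i * \<xi> / 2)"
      using jump by linarith
    then have "(k i * wp \<xi> - k (i - 1) * wm \<xi>) / (\<xi> * t) = - (d i * \<xi> / 2) / (\<xi> * t)"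
      by (simp only:)
    then have "(k i * wp \<xi> - k (i - 1) * wm \<xi>) / (\<xi> * t) = - d i / (2 * t)"
      using \<xi> by (simp add: mult.commute)
    ultimately have "k i *\<^sub>R ?gp - k (i - 1) *\<^sub>R ?gm = (- d i / (2 * t)) *\<^sub>R x"
      by (simp add: diff_divide_distrib scaleR_left_diff_distrib[symmetric])
    then have "- d i * \<nu>t + inner (k i *\<^sub>R ?gp - k (i - 1) *\<^sub>R ?gm) \<nu>x =
        - d i * \<nu>t + inner ((- d i / (2 * t)) *\<^sub>R x) \<nu>x"
      by (simp only:)
    also have "\<dots> = - d i * (\<nu>t + inner x \<nu>x / (2 * t))"
      by (simp add: algebra_simps)
    finally show "- d i * \<nu>t + inner (k i *\<^sub>R ?gp - k (i - 1) *\<^sub>R ?gm) \<nu>x = 0"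
      using * by simp
  qed
qed

section \<open>The self-similar profile\<close>

text \<open>Each step adds the next piece inwards, so at stage i the piece \<open>w i\<close>
  reaches down to 0. Keeping every stage defined on all positive reals permits induction for
  continuity and monotonicity.\<close>

primrec glue :: "(nat \<Rightarrow> real) \<Rightarrow> (nat \<Rightarrow> real \<Rightarrow> real) \<Rightarrow> nat \<Rightarrow> real \<Rightarrow> real" where
  "glue x w 0 r = w 0 r"
| "glue x w (Suc i) r = (if r \<le> x (Suc i) then w (Suc i) r else glue x w i r)"

lemma glue_last: "i = 0 \<or> r \<le> x i \<Longrightarrow> glue x w i r = w i r"
  by (cases i) auto

text \<open>Every piece is continuous and decreasing on all positive reals, so replacing the
  function left of \<open>x (Suc j)\<close> by a piece with the same value there preserves both
  properties.\<close>

lemma glue_props: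
  assumes x: "\<And>i. 1 \<le> i \<Longrightarrow> i \<le> m \<Longrightarrow> 0 < x i" "\<And>i. 1 \<le> i \<Longrightarrow> i < m \<Longrightarrow> x (Suc i) < x i"
    and cont: "\<And>i. i \<le> m \<Longrightarrow> continuous_on {0<..} (w i)"
    and anti: "\<And>i r s. i \<le> m \<Longrightarrow> 0 < r \<Longrightarrow> r < s \<Longrightarrow> w i s < w i r"
    and match: "\<And>i. i < m \<Longrightarrow> w (Suc i) (x (Suc i)) = w i (x (Suc i))"
    and "j \<le> m"
  shows "continuous_on {0<..} (glue x w j) \<and> (\<forall>r s. 0 < r \<longrightarrow> r < s \<longrightarrow> glue x w j s < glue x w j r) \<and>
    (\<forall>i<j. \<forall>r. x (Suc i) \<le> r \<longrightarrow> i = 0 \<or> r \<le> x i \<longrightarrow> glue x w j r = w i r)"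
  using \<open>j \<le> m\<close>
proof (induction j)
  case 0
  then show ?case using cont[of 0] anti[of 0] by (auto simp: fun_eq_iff cong: continuous_on_cong)
next
  case (Suc j)
  let ?x = "x (Suc j)"
  have IH: "continuous_on {0<..} (glue x w j)" "\<And>r s. 0 < r \<Longrightarrow> r < s \<Longrightarrow> glue x w j s < glue x w j r"
    "\<And>i r. i < j \<Longrightarrow> x (Suc i) \<le> r \<Longrightarrow> i = 0 \<or> r \<le> x i \<Longrightarrow> glue x w j r = w i r"
    using Suc by auto
  have xpos: "0 < ?x" using x Suc by simp
  \<comment> \<open>The new front lies where the last piece \<open>w j\<close> is still in force, so
    \<open>match\<close> is precisely agreement at the seam.\<close>
  have at_x: "glue x w j ?x = w (Suc j) ?x"
    using match[of j] x(2)[of j] Suc.prems by (subst glue_last) (auto simp: Suc_le_eq intro: less_imp_le)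
  have mono_x: "x l \<le> x (Suc i)" if "Suc i \<le> l" "l \<le> m" for i l
    using that
  proof (induction l rule: dec_induct)
    case (step l)
    then have "x (Suc l) < x l" by (intro x(2)) auto
    with step show ?case by simp
  qed simp
  have eq: "glue x w (Suc j) = (\<lambda>r. if r \<le> ?x then w (Suc j) r else glue x w j r)"
    by (simp add: fun_eq_iff)
  show ?case
  proof (intro conjI allI impI)
    have "continuous_on ({0<..?x} \<union> {?x..}) (\<lambda>r. if r \<le> ?x then w (Suc j) r else glue x w j r)"
    proof (rule continuous_on_cases_local)
      show "closedin (top_of_set ({0<..?x} \<union> {?x..})) {0<..?x}"
        using xpos by (auto simp: closedin_closed intro!: exI[of _ "{..?x}"])
      show "closedin (top_of_set ({0<..?x} \<union> {?x..})) {?x..}"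
        by (auto simp: closedin_closed intro!: exI[of _ "{?x..}"])
      show "continuous_on {0<..?x} (w (Suc j))"
        by (rule continuous_on_subset[OF cont[OF Suc.prems]]) auto
      show "continuous_on {?x..} (glue x w j)"
        by (rule continuous_on_subset[OF IH(1)]) (use xpos in auto)
    qed (use at_x in auto)
    moreover have "{0<..?x} \<union> {?x..} = {0<..}" using xpos by auto
    ultimately show "continuous_on {0<..} (glue x w (Suc j))" unfolding eq by simp
  next
    fix r s :: real assume rs: "0 < r" "r < s"
    consider "s \<le> ?x" | "r \<le> ?x" "?x < s" | "?x < r" by linarith
    then show "glue x w (Suc j) s < glue x w (Suc j) r"
    proof cases
      case 1
      then show ?thesis using anti[OF Suc.prems rs] rs by simp
    next
      case 2
      have "glue x w j s < w (Suc j) ?x" using IH(2)[of ?x s] 2 xpos at_x by simp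
      also have "w (Suc j) ?x \<le> w (Suc j) r"
        using anti[OF Suc.prems, of r ?x] 2 rs by (cases "r = ?x") auto
      finally show ?thesis using 2 by simp
    next
      case 3
      then show ?thesis using IH(2)[OF rs] rs by simp
    qed
  next
    fix i r assume i: "i < Suc j" "x (Suc i) \<le> r" "i = 0 \<or> r \<le> x i"
    have r: "?x \<le> r" using mono_x[of i "Suc j"] i Suc.prems by auto
    have "glue x w j r = w i r"
      using IH(3)[of i r] i glue_last[of j r x w] by (cases "i = j") auto
    then show "glue x w (Suc j) r = w i r" using r at_x by (cases "r = ?x") auto
  qed
qed

context stefan_fronts
begin

definition w :: "nat \<Rightarrow> real \<Rightarrow> real" where
  "w i r = U i + c i * (H i r - (if i = 0 then 0 else H i (x i)))"

definition v :: "real \<Rightarrow> real" where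
  "v = glue x w m"

definition phase :: "nat \<Rightarrow> real set" where
  "phase i = {r. 0 < r \<and> (i < m \<longrightarrow> x (Suc i) < r) \<and> (0 < i \<longrightarrow> r < x i)}"

lemma v_glue: "continuous_on {0<..} v \<and> (\<forall>r s. 0 < r \<longrightarrow> r < s \<longrightarrow> v s < v r) \<and>
    (\<forall>i<m. \<forall>r. x (Suc i) \<le> r \<longrightarrow> i = 0 \<or> r \<le> x i \<longrightarrow> v r = w i r)"
  unfolding v_def
proof (rule glue_props[where m = m])
  show "continuous_on {0<..} (w i)" if "i \<le> m" for i
    unfolding w_def by (intro continuous_intros continuous_on_H that)
  show "w i s < w i r" if "i \<le> m" "0 < r" "r < s" for i r s
    using H_less_iff[of i s r] c_pos[of i] that by (simp add: w_def)
  show "w (Suc i) (x (Suc i)) = w i (x (Suc i))" if "i < m" for i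
    using drop[OF that] by (simp add: w_def)
qed (use x_pos x_less in auto)

lemma v_cont: "continuous_on {0<..} v"
  and v_anti: "0 < r \<Longrightarrow> r < s \<Longrightarrow> v s < v r"
  using v_glue by auto

lemma v_less_iff: "0 < r \<Longrightarrow> 0 < s \<Longrightarrow> v s < v r \<longleftrightarrow> r < s"
  using v_anti[of r s] v_anti[of s r] by (cases r s rule: linorder_cases) auto

lemma v_eq: "i \<le> m \<Longrightarrow> (i < m \<Longrightarrow> x (Suc i) \<le> r) \<Longrightarrow> (0 < i \<Longrightarrow> r \<le> x i) \<Longrightarrow> v r = w i r"
proof (cases "i = m")
  case True
  then show "(0 < i \<Longrightarrow> r \<le> x i) \<Longrightarrow> v r = w i r"
    using m_pos glue_last[of m r x w] by (simp add: v_def)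
next
  case False
  then show "i \<le> m \<Longrightarrow> (i < m \<Longrightarrow> x (Suc i) \<le> r) \<Longrightarrow> (0 < i \<Longrightarrow> r \<le> x i) \<Longrightarrow> v r = w i r"
    using v_glue by (cases "i = 0") auto
qed

lemma v_eq_phase: "i \<le> m \<Longrightarrow> r \<in> phase i \<Longrightarrow> v r = w i r"
  by (rule v_eq) (auto simp: phase_def)

lemma v_x: "1 \<le> i \<Longrightarrow> i \<le> m \<Longrightarrow> v (x i) = U i"
  using v_eq[of i "x i"] x_less[of i] by (force simp: w_def)

text \<open>\<open>U 0\<close> is only the limit at infinity. A point further out in phase 0 already
  exceeds it because \<open>H 0\<close> is positive, and \<open>v\<close> decreases.\<close>

lemma v_gt:
  assumes "0 < r"
  shows "U 0 < v r"
proof -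
  define s where "s = max (r + 1) (x 1)"
  have s: "r < s" "0 < s" "x 1 \<le> s" using assms by (auto simp: s_def)
  have "U 0 < w 0 s" using c_pos[of 0] H_pos[of 0 s] s by (simp add: w_def)
  also have "w 0 s = v s" using v_eq[of 0 s] s by simp
  also have "v s < v r" using v_anti assms s by simp
  finally show ?thesis .
qed

section \<open>Phases and transition surfaces of the profile\<close>

lemma open_phase: "open (phase i)"
proof -
  have "phase i = {0<..} \<inter> (if i < m then {x (Suc i)<..} else UNIV) \<inter> (if 0 < i then {..<x i} else UNIV)"
    by (auto simp: phase_def)
  then show ?thesis by (simp add: open_Int)
qed

text \<open>\<open>v\<close> is strictly decreasing with \<open>v (x i) = U i\<close>, so
  temperature bounds are bounds on r in reverse order. The bound \<open>U 0\<close> has no front and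
  holds everywhere by \<open>v_gt\<close>.\<close>

lemma phase_region_v:
  assumes "i \<le> m"
  shows "phase_region m U (\<lambda>t (y :: real^'n). v (norm y / sqrt t)) i = radial_set (phase i)"
proof (rule set_eqI)
  have eq: "U i < v r \<and> (i < m \<longrightarrow> v r < U (Suc i)) \<longleftrightarrow> r \<in> phase i" if "0 < r" for r
  proof -
    have "U i < v r \<longleftrightarrow> (0 < i \<longrightarrow> r < x i)"
      using v_gt[OF that] v_x[of i] x_pos[of i] v_less_iff[OF that, of "x i"] assms by (cases "i = 0") auto
    moreover have "v r < U (Suc i) \<longleftrightarrow> x (Suc i) < r" if "i < m"
      using v_x[of "Suc i"] x_pos[of "Suc i"] v_less_iff[OF _ \<open>0 < r\<close>, of "x (Suc i)"] that by auto
    ultimately show ?thesis using that by (auto simp: phase_def)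
  qed
  fix q :: "real \<times> (real^'n)"
  show "q \<in> phase_region m U (\<lambda>t (y :: real^'n). v (norm y / sqrt t)) i \<longleftrightarrow> q \<in> radial_set (phase i)"
  proof (cases "0 < fst q \<and> snd q \<noteq> 0")
    case True
    then have "0 < norm (snd q) / sqrt (fst q)" by simp
    from eq[OF this] True show ?thesis
      unfolding phase_region_def radial_set_def stefan_domain_def case_prod_beta mem_Collect_eq
        fst_conv snd_conv
      by blast
  qed (auto simp: phase_region_def radial_set_def stefan_domain_def)
qed

lemma transition_surface_v:
  assumes "1 \<le> i" "i \<le> m"
  shows "transition_surface U (\<lambda>t (y :: real^'n). v (norm y / sqrt t)) i = radial_set {x i}"
proof -
  have eq: "r = x i" if "0 < r" "v r = U i" for r
  proof (rule ccontr)
    assume "r \<noteq> x i"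
    then consider "r < x i" | "x i < r" by linarith
    then show False
      using v_anti[OF that(1), of "x i"] v_anti[OF x_pos[OF assms], of r] v_x[OF assms] that(2)
      by cases auto
  qed
  show ?thesis
  proof (rule set_eqI)
    fix q :: "real \<times> (real^'n)"
    show "q \<in> transition_surface U (\<lambda>t (y :: real^'n). v (norm y / sqrt t)) i \<longleftrightarrow> q \<in> radial_set {x i}"
    proof (cases "0 < fst q \<and> snd q \<noteq> 0")
      case True
      then have "0 < norm (snd q) / sqrt (fst q)" by simp
      then show ?thesis
        using eq v_x[OF assms]
        unfolding transition_surface_def radial_set_def stefan_domain_def case_prod_beta
          mem_Collect_eq singleton_iff fst_conv snd_conv
        by metis
    qed (auto simp: transition_surface_def radial_set_def stefan_domain_def)
  qed
qed

section \<open>Verification of the equations and limit conditions\<close>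

lemma has_real_derivative_h:
  assumes "i \<le> m" "0 < r"
  shows "(h i has_real_derivative (- (real n - 1) / r - r / (2 * (a i)\<^sup>2)) * h i r) (at r)"
proof -
  have a: "0 < a i" using a_pos assms by simp
  have "((\<lambda>r. stefan_g n (r / a i)) has_real_derivative
      ((- (real n - 1) / (r / a i) - (r / a i) / 2) * stefan_g n (r / a i)) * (1 / a i)) (at r)"
    by (rule DERIV_chain'[OF _ has_real_derivative_stefan_g])
       (use assms a n in \<open>auto intro!: derivative_eq_intros\<close>)
  from DERIV_cdivide[OF this, of "a i"] show ?thesis
    unfolding h_def[of i, abs_def]
    by (rule DERIV_cong) (use assms a in \<open>simp add: h_def field_simps power2_eq_square\<close>)
qed

lemma has_real_derivative_v:
  assumes "i \<le> m" "r \<in> phase i"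
  shows "(v has_real_derivative - c i * h i r) (at r)"
proof (rule has_field_derivative_transform_within_open[OF _ open_phase assms(2)])
  show "w i s = v s" if "s \<in> phase i" for s using v_eq_phase[OF assms(1) that] by simp
  have "0 < r" using assms(2) by (simp add: phase_def)
  then show "(w i has_real_derivative - c i * h i r) (at r)"
    unfolding w_def by (auto intro!: derivative_eq_intros has_real_derivative_H assms(1))
qed

lemma heat_solution_v:
  assumes "i \<le> m" "n = CARD('n::finite)"
  shows "heat_solution_on (phase_region m U (\<lambda>t (y :: real^'n). v (norm y / sqrt t)) i) ((a i)\<^sup>2)
    (\<lambda>t (y :: real^'n). v (norm y / sqrt t))"
  unfolding phase_region_v[OF assms(1)]
proof (rule heat_solution_on_radial_set[OF open_phase _ has_real_derivative_v[OF assms(1)]])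
  \<comment> \<open>The logarithmic derivative of \<open>h i\<close> has two terms: the first
    cancels the curvature term (n - 1) / r of the radial Laplacian, and the second, multiplied by
    \<open>(a i)\<^sup>2\<close>, gives the right side of the equation.\<close>
  let ?w' = "\<lambda>r. - c i * ((- (real n - 1) / r - r / (2 * (a i)\<^sup>2)) * h i r)"
  show "phase i \<subseteq> {0<..}" by (auto simp: phase_def)
  show "((\<lambda>r. - c i * h i r) has_real_derivative ?w' r) (at r)" if "r \<in> phase i" for r
    using that assms by (intro DERIV_cmult has_real_derivative_h) (auto simp: phase_def)
  show "continuous_on (phase i) ?w'"
    by (intro continuous_intros continuous_on_subset[OF continuous_on_h[OF assms(1)]])
       (use a_pos[OF assms(1)] in \<open>auto simp: phase_def\<close>)
  show "(a i)\<^sup>2 * (?w' r + (real CARD('n) - 1) / r * (- c i * h i r)) = - r / 2 * (- c i * h i r)"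
    for r
  proof -
    define P where "P = (real n - 1) / r"
    have P: "- (real n - 1) / r = - P" by (simp add: P_def minus_divide_left)
    have "?w' r + P * (- c i * h i r) = r / (2 * (a i)\<^sup>2) * (c i * h i r)"
      unfolding P by (simp add: algebra_simps)
    moreover have "(a i)\<^sup>2 * (r / (2 * (a i)\<^sup>2) * (c i * h i r)) = - r / 2 * (- c i * h i r)"
      using a_pos[OF assms(1)] by simp
    ultimately show ?thesis by (simp only: assms(2)[symmetric] P_def)
  qed
qed

lemma stefan_condition_v:
  assumes "1 \<le> i" "i \<le> m"
  shows "stefan_condition m U k d (\<lambda>t (y :: real^'n). v (norm y / sqrt t)) i"
proof -
  obtain j where i: "i = Suc j" "j < m" using assms by (cases i) auto
  \<comment> \<open>The neighbouring fronts bound the two phases. The innermost phase ends at 0, and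
    the outermost is unbounded, so any number above \<open>x i\<close> serves as
    \<open>hi\<close>.\<close>
  define lo where "lo = (if i < m then x (Suc i) else 0)"
  define hi where "hi = (if j = 0 then x i + 1 else x j)"
  have xi: "0 < x i" using x_pos assms by simp
  have lo_nonneg: "0 \<le> lo" using x_pos[of "Suc i"] by (auto simp: lo_def)
  have lo_less: "lo < x i" using x_less[of i] xi assms by (cases "i < m") (simp_all add: lo_def)
  have cont: "isCont (\<lambda>r. - c l * h l r) (x i)" if "l \<le> m" for l
    using continuous_on_h[OF that] xi
    by (intro continuous_intros) (simp add: continuous_on_eq_continuous_at)
  show ?thesis
  proof (rule stefan_condition_radial[OF refl transition_surface_v[OF assms] phase_region_v phase_region_v[OF assms(2)]])
    show "lo < x i" by (rule lo_less)
    show "{lo<..<x i} \<subseteq> phase i"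
      using lo_nonneg by (auto simp: phase_def lo_def split: if_splits)
    show "x i < hi" using x_less[of j] i by (simp add: hi_def)
    show "{x i<..<hi} \<subseteq> phase (i - 1)"
      using xi i by (auto simp: phase_def hi_def split: if_splits)
    show "d i * x i / 2 + k i * (- c i * h i (x i)) - k (i - 1) * (- c (i - 1) * h (i - 1) (x i)) = 0"
      using jump[OF i(2)] i by simp
    show "(v has_real_derivative - c (i - 1) * h (i - 1) r) (at r)" if "r \<in> phase (i - 1)" for r
      using that assms by (intro has_real_derivative_v) auto
    show "(v has_real_derivative - c i * h i r) (at r)" if "r \<in> phase i" for r
      using that assms by (intro has_real_derivative_v) auto
    show "isCont (\<lambda>r. - c (i - 1) * h (i - 1) r) (x i)"
      using assms by (intro cont) auto
    show "isCont (\<lambda>r. - c i * h i r) (x i)"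
      using assms by (intro cont) auto
  qed (use assms xi in auto)
qed

text \<open>For fixed nonzero y the similarity variable tends to infinity as t tends to 0, so only
  phase 0 is seen, where \<open>H 0\<close> vanishes in the limit.\<close>

lemma initial_v:
  assumes "y \<noteq> 0"
  shows "((\<lambda>t. v (norm (y :: real^'n) / sqrt t)) \<longlongrightarrow> U 0) (at_right 0)"
proof -
  have "(w 0 \<longlongrightarrow> U 0 + c 0 * (0 - 0)) at_top"
    unfolding w_def by (intro tendsto_intros H_at_top) simp_all
  then have "(w 0 \<longlongrightarrow> U 0) at_top" by simp
  moreover have "\<forall>\<^sub>F r in at_top. w 0 r = v r"
    using eventually_ge_at_top[of "x 1"] by eventually_elim (use v_eq[of 0] in simp)
  ultimately have v: "(v \<longlongrightarrow> U 0) at_top" by (rule Lim_transform_eventually)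
  have "filterlim (\<lambda>t::real. inverse (sqrt t)) at_top (at_right 0)"
    using eventually_at_right_less[of "0::real"]
    by (intro filterlim_inverse_at_top) (auto intro!: tendsto_eq_intros elim!: eventually_mono)
  then have "filterlim (\<lambda>t. norm y * inverse (sqrt t)) at_top (at_right 0)"
    by (intro filterlim_tendsto_pos_mult_at_top[OF tendsto_const]) (use assms in auto)
  from filterlim_compose[OF v this] show ?thesis by (simp add: divide_inverse)
qed

text \<open>Near 0 the profile is a constant plus A * G. Division by A * E removes the constant,
  because E diverges, and leaves the quotient G / E with limit 1.\<close>

lemma asymp_v:
  assumes "0 < t"
  shows "(\<lambda>y :: real^'n. v (norm y / sqrt t)) \<sim>[at 0] (\<lambda>y. A * stefan_E n (norm y / (a m * sqrt t)))"
proof -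
  have am: "0 < a m" and A: "0 < A" using a_pos c_pos[of m] c_m by auto
  have E: "\<forall>\<^sub>F s in at_right 0. 0 < stefan_E n s"
    using stefan_E_at_top[OF n] by (auto simp: filterlim_at_top_dense)
  let ?f = "\<lambda>s. (U m - A * H m (x m)) / A * inverse (stefan_E n s) + stefan_G n (ereal s) / stefan_E n s"
  have "(?f \<longlongrightarrow> (U m - A * H m (x m)) / A * 0 + 1) (at_right 0)"
    by (intro tendsto_add tendsto_mult tendsto_const stefan_G_over_E n
        tendsto_inverse_0_at_top stefan_E_at_top)
  then have lim: "(?f \<longlongrightarrow> 1) (at_right 0)" by simp
  have "((\<lambda>s. v (a m * s) / (A * stefan_E n s)) \<longlongrightarrow> 1) (at_right 0)"
  proof (rule Lim_transform_eventually[OF lim])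
    have "\<forall>\<^sub>F s in at_right 0. 0 < s \<and> s < x m / a m"
      using am x_pos[of m] m_pos by (intro eventually_at_rightI[of 0 "x m / a m"]) auto
    with E show "\<forall>\<^sub>F s in at_right 0. ?f s = v (a m * s) / (A * stefan_E n s)"
    proof eventually_elim
      case (elim s)
      then have "v (a m * s) = w m (a m * s)"
        using am by (intro v_eq) (auto simp: field_simps)
      then have "v (a m * s) = (U m - A * H m (x m)) + A * stefan_G n (ereal s)"
        using am m_pos by (simp add: w_def c_m H_def[of m "a m * s"] right_diff_distrib)
      then show ?case using elim A by (simp add: field_simps)
    qed
  qed
  moreover have "filterlim (\<lambda>y :: real^'n. norm y / (a m * sqrt t)) (at_right 0) (at 0)"
    unfolding filterlim_at
  proof
    show "\<forall>\<^sub>F y :: real^'n in at 0. norm y / (a m * sqrt t) \<in> {0<..} \<and> norm y / (a m * sqrt t) \<noteq> 0"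
      unfolding eventually_at_filter using am assms by (auto intro!: always_eventually)
    show "((\<lambda>y :: real^'n. norm y / (a m * sqrt t)) \<longlongrightarrow> 0) (at 0)"
      by (rule tendsto_eq_intros refl | use am assms in simp)+
  qed
  ultimately have "((\<lambda>y :: real^'n. v (a m * (norm y / (a m * sqrt t))) /
      (A * stefan_E n (norm y / (a m * sqrt t)))) \<longlongrightarrow> 1) (at 0)"
    by (rule filterlim_compose)
  then show ?thesis
    using am by (intro asymp_equivI') simp
qed

lemma continuous_on_v: "continuous_on stefan_domain (\<lambda>(t, y :: real^'n). v (norm y / sqrt t))"
  unfolding case_prod_beta
  by (rule continuous_on_compose2[OF v_cont continuous_on_similarity])
     (auto simp: stefan_domain_def)

lemma stefan_solution_v:
  assumes "n = CARD('n::finite)"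
  shows "stefan_solution m U a k d A (\<lambda>t (y :: real^'n). v (norm y / sqrt t))"
  unfolding stefan_solution_def
  using continuous_on_v heat_solution_v[OF _ assms] stefan_condition_v initial_v asymp_v assms by auto

definition \<xi> :: "nat \<Rightarrow> ereal" where
  "\<xi> i = (if i = 0 then \<infinity> else ereal (x i))"

lemma stefan_profile_v: "stefan_profile n m U a A \<xi> v"
  unfolding stefan_profile_def
proof (intro conjI allI impI ballI)
  fix r assume "0 < r" "ereal r < \<xi> m"
  then have "v r = w m r" using m_pos by (intro v_eq) (auto simp: \<xi>_def)
  then show "v r = U m + A * (stefan_G n (ereal (r / a m)) - stefan_G n (\<xi> m / ereal (a m)))"
    using m_pos a_pos[of m] by (simp add: w_def c_m H_def \<xi>_def)
next
  fix i r assume i: "i < m" "\<xi> (Suc i) < ereal r" "ereal r < \<xi> i"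
  then have v: "v r = w i r" by (intro v_eq) (auto simp: \<xi>_def split: if_splits)
  have a: "a i > 0" using a_pos i by simp
  have G: "stefan_G n (\<xi> i / ereal (a i)) = (if i = 0 then 0 else H i (x i))"
    "stefan_G n (\<xi> (Suc i) / ereal (a i)) = H i (x (Suc i))"
    "stefan_G n (ereal (r / a i)) = H i r"
    using a by (auto simp: \<xi>_def H_def)
  \<comment> \<open>With a nonzero denominator, \<open>drop\<close> identifies \<open>c i\<close>
    with the quotient of the temperature difference by the difference of G values in the displayed
    profile.\<close>
  have "H i (x (Suc i)) - (if i = 0 then 0 else H i (x i)) \<noteq> 0"
    using drop[OF i(1)] U_less[OF i(1)] by auto
  then show "v r = U i + (U (Suc i) - U i) *
      (stefan_G n (ereal (r / a i)) - stefan_G n (\<xi> i / ereal (a i))) /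
      (stefan_G n (\<xi> (Suc i) / ereal (a i)) - stefan_G n (\<xi> i / ereal (a i)))"
    unfolding G v w_def drop[OF i(1)] by simp
next
  fix i assume "i \<in> {1..m}"
  then show "v (real_of_ereal (\<xi> i)) = U i" using v_x by (simp add: \<xi>_def)
qed

lemma radial_set_eq:
  assumes "1 \<le> i"
  shows "radial_set {x i} = {(t, y :: real^'n). 0 < t \<and> y \<noteq> 0 \<and> ereal (norm y) = \<xi> i * ereal (sqrt t)}"
  using assms by (auto simp: radial_set_def stefan_domain_def \<xi>_def field_simps)

end

theorem theorem2p2:
  fixes m :: nat and U a k d :: "nat \<Rightarrow> real" and A :: real
  assumes "CARD('n::finite) \<ge> 2"
    and "m \<ge> 1"
    and "\<forall>i<m. U i < U (Suc i)"
    and "\<forall>i\<le>m. a i > 0"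
    and "\<forall>i\<le>m. k i > 0"
    and "\<forall>i\<in>{1..m}. d i \<ge> 0"
    and "A > 0"
  shows "\<exists>(\<xi> :: nat \<Rightarrow> ereal) (v :: real \<Rightarrow> real).
           \<xi> 0 = \<infinity> \<and> (\<forall>i<m. \<xi> (Suc i) < \<xi> i) \<and> 0 < \<xi> m \<and>
           stefan_profile CARD('n) m U a A \<xi> v \<and>
           stefan_solution m U a k d A (\<lambda>t (x :: real^'n). v (norm x / sqrt t)) \<and>
           (\<forall>i\<in>{1..m}. transition_surface U (\<lambda>t (x :: real^'n). v (norm x / sqrt t)) i =
              {(t, x). 0 < t \<and> x \<noteq> 0 \<and> ereal (norm x) = \<xi> i * ereal (sqrt t)})"
proof -
  interpret D: stefan_data "CARD('n)" m U a k d
    by unfold_locales (use assms in auto)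
  obtain x c where "stefan_fronts CARD('n) m U a k d A x c"
    using D.exists_fronts[of A] assms by auto
  then interpret F: stefan_fronts "CARD('n)" m U a k d A x c .
  show ?thesis
  proof (intro exI[of _ F.\<xi>] exI[of _ F.v] conjI ballI allI impI)
    show "F.\<xi> (Suc i) < F.\<xi> i" if "i < m" for i
      using F.x_less[of i] that by (simp add: F.\<xi>_def)
    show "0 < F.\<xi> m" using F.x_pos[of m] assms(2) by (simp add: F.\<xi>_def)
    show "transition_surface U (\<lambda>t (x :: real^'n). F.v (norm x / sqrt t)) i =
        {(t, x). 0 < t \<and> x \<noteq> 0 \<and> ereal (norm x) = F.\<xi> i * ereal (sqrt t)}" if "i \<in> {1..m}" for i
      using that by (intro trans[OF F.transition_surface_v F.radial_set_eq]) auto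
  qed (simp_all add: F.stefan_profile_v F.stefan_solution_v F.\<xi>_def)
qed

end
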